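(* Fix a rooted tree $B$ with at least one edge. For $g\ge3$ let $G_g$ be the cycle $C_g$ with $B$ attached (by its root) at a single cycle vertex $v_0$, every other cycle vertex having degree $2$. The limit $\lambda_\infty:=\lim_{g\to\infty}\lambda_{\max}(R_{G_g})$ exists and is positive; let $\mu>1$ be the larger root of $\mu+\mu^{-1}=2(1+\lambda_\infty)$. Let $w^\ast$ be the Perron eigenvector of $R_{G_g}$, $c_1,\dots,c_g$ the consecutive cycle edges (indices mod $g$), and $L=\sum_jw^\ast(c_j)$. Then $$r_\infty:=\lim_{g\to\infty}\max_j\frac{w^\ast(c_{j-1})+w^\ast(c_j)+w^\ast(c_{j+1})}{L}=g_{*}(\mu),\qquad g_{*}(\mu):=\frac{(2\mu+1)(\mu-1)}{2\mu^2}.$$ The function $g_*$ is strictly increasing (on $\mu>1$), and $g_*(\mu)=\tfrac12\iff\mu^2-\mu-1=0\iff\mu=\varphi:=\tfrac{1+\sqrt5}{2}$. Equivalently, since $\lambda_\infty=(\mu-1)^2/(2\mu)$, $$r_\infty<\tfrac12\iff\lambda_\infty<\varphi-\tfrac32,\qquad r_\infty>\tfrac12\iff\lambda_\infty>\varphi-\tfrac32,\qquad \varphi-\tfrac32=\tfrac{\sqrt5-2}{2}.$$ Consequently, if $\lambda_\infty<\varphi-\tfrac32$, then for all sufficiently large $g$ one has $w^\ast(c_{j-1})+w^\ast(c_j)+w^\ast(c_{j+1})\le L/2$ for every $j$, and $w^\ast$ is a discrete Einstein metric on $G_g$ with curvature $\kappa=-\lambda_{\max}(R_{G_g})$.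
   Context: Weighted graphs: $G=(V,E)$ is a finite connected simple graph, $w:E\to\mathbb{R}_{>0}$ an edge weighting, $d_v$ the combinatorial degree, and $d(x,y)$ the least total weight of a path from $x$ to $y$. Lin--Lu--Yau curvature: for $\alpha\in[0,1]$ let $\mu_x^\alpha$ be the probability measure with mass $\alpha$ at $x$ and $(1-\alpha)/d_x$ at each neighbour of $x$. Let $W$ be the $L^1$-Wasserstein distance with respect to $d$. For an edge $x\sim y$ put $\kappa_\alpha(x,y)=1-W(\mu_x^\alpha,\mu_y^\alpha)/d(x,y)$ and $\kappa_{xy}=\lim_{\alpha\to1}\kappa_\alpha(x,y)/(1-\alpha)$. A positive weighting $w$ is a discrete Einstein metric of curvature $\kappa$ if $\kappa_e=\kappa$ for every edge $e$. Ricci matrix: $R_G\in\mathbb{R}^{E\times E}$ has diagonal entries $-(1/d_x+1/d_y)$ for $e=\{x,y\}$, entry $1/d_z$ for $e\ne e'$ with $e\cap e'=\{z\}$, and $0$ for disjoint edges. $\lambda_{\max}(R_G)$ is its largest eigenvalue; it is simple, with a positive (Perron) eigenvector $w^\ast$, unique up to scaling. *)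

theory Defs
  imports "HOL-Probability.Probability"
begin

(* A finite simple graph is a vertex set V together with a set E of two-element subsets of V. *)

definition simple_graph :: "'v set \<Rightarrow> 'v set set \<Rightarrow> bool" where
  "simple_graph V E \<longleftrightarrow> finite V \<and> (\<forall>e\<in>E. \<exists>x\<in>V. \<exists>y\<in>V. x \<noteq> y \<and> e = {x, y})"

definition neighbours :: "'v set set \<Rightarrow> 'v \<Rightarrow> 'v set" where
  "neighbours E x = {y. {x, y} \<in> E}"

definition degree :: "'v set set \<Rightarrow> 'v \<Rightarrow> nat" where
  "degree E x = card (neighbours E x)"

definition paths :: "'v set \<Rightarrow> 'v set set \<Rightarrow> 'v \<Rightarrow> 'v \<Rightarrow> 'v list set" where
  "paths V E x y = {p. p \<noteq> [] \<and> hd p = x \<and> last p = y \<and> set p \<subseteq> V \<and> distinct p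
                       \<and> successively (\<lambda>a b. {a, b} \<in> E) p}"

definition connected_graph :: "'v set \<Rightarrow> 'v set set \<Rightarrow> bool" where
  "connected_graph V E \<longleftrightarrow> V \<noteq> {} \<and> (\<forall>x\<in>V. \<forall>y\<in>V. paths V E x y \<noteq> {})"

definition has_cycle :: "'v set set \<Rightarrow> bool" where
  "has_cycle E \<longleftrightarrow> (\<exists>p. length p \<ge> 3 \<and> distinct p
                       \<and> successively (\<lambda>a b. {a, b} \<in> E) p \<and> {last p, hd p} \<in> E)"

definition rooted_tree :: "'v set \<Rightarrow> 'v set set \<Rightarrow> 'v \<Rightarrow> bool" where
  "rooted_tree V E r \<longleftrightarrow> simple_graph V E \<and> connected_graph V E \<and> \<not> has_cycle E \<and> r \<in> V"

definition path_weight :: "('v set \<Rightarrow> real) \<Rightarrow> 'v list \<Rightarrow> real" where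
  "path_weight w p = (\<Sum>(a, b) \<leftarrow> zip p (tl p). w {a, b})"

definition weighted_dist :: "'v set \<Rightarrow> 'v set set \<Rightarrow> ('v set \<Rightarrow> real) \<Rightarrow> 'v \<Rightarrow> 'v \<Rightarrow> real" where
  "weighted_dist V E w x y = Min (path_weight w ` paths V E x y)"

definition wasserstein :: "('v \<Rightarrow> 'v \<Rightarrow> real) \<Rightarrow> 'v pmf \<Rightarrow> 'v pmf \<Rightarrow> real" where
  "wasserstein d M N =
     Inf {measure_pmf.expectation P (\<lambda>(x, y). d x y) | P. map_pmf fst P = M \<and> map_pmf snd P = N}"

definition lazy_measure :: "'v set set \<Rightarrow> real \<Rightarrow> 'v \<Rightarrow> 'v pmf" where
  "lazy_measure E a x =
     bind_pmf (bernoulli_pmf a) (\<lambda>stay. if stay then return_pmf x else pmf_of_set (neighbours E x))"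

lemma pmf_lazy_measure:
  assumes "simple_graph V E" and "neighbours E x \<noteq> {}" and "0 \<le> a" "a \<le> 1"
  shows "pmf (lazy_measure E a x) y =
           (if y = x then a else if y \<in> neighbours E x then (1 - a) / degree E x else 0)"
proof -
  have sub: "neighbours E x \<subseteq> V" and irr: "x \<notin> neighbours E x"
    using assms(1) by (auto simp: simple_graph_def neighbours_def doubleton_eq_iff)
  have "finite V" using assms(1) by (simp add: simple_graph_def)
  with sub have "finite (neighbours E x)" by (rule finite_subset)
  with assms irr show ?thesis
    by (auto simp: lazy_measure_def pmf_bind degree_def indicator_def)
qed

definition lly_kappa ::
    "'v set \<Rightarrow> 'v set set \<Rightarrow> ('v set \<Rightarrow> real) \<Rightarrow> real \<Rightarrow> 'v \<Rightarrow> 'v \<Rightarrow> real" where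
  "lly_kappa V E w a x y =
     1 - wasserstein (weighted_dist V E w) (lazy_measure E a x) (lazy_measure E a y)
           / weighted_dist V E w x y"

(* A relation rather than a value, so that existence of the limit is part of the assertion. *)
definition has_lly_curvature ::
    "'v set \<Rightarrow> 'v set set \<Rightarrow> ('v set \<Rightarrow> real) \<Rightarrow> 'v \<Rightarrow> 'v \<Rightarrow> real \<Rightarrow> bool" where
  "has_lly_curvature V E w x y k \<longleftrightarrow>
     ((\<lambda>a. lly_kappa V E w a x y / (1 - a)) \<longlongrightarrow> k) (at_left 1)"

definition discrete_einstein_metric ::
    "'v set \<Rightarrow> 'v set set \<Rightarrow> ('v set \<Rightarrow> real) \<Rightarrow> real \<Rightarrow> bool" where
  "discrete_einstein_metric V E w k \<longleftrightarrow>
     (\<forall>e\<in>E. 0 < w e) \<and> (\<forall>x y. {x, y} \<in> E \<longrightarrow> has_lly_curvature V E w x y k)"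

(* Matrices in R^(E x E) are functions of two edges, only used on the finite index set E.
   For distinct edges of a simple graph the intersection has at most one element. *)
definition ricci_matrix :: "'v set set \<Rightarrow> 'v set \<Rightarrow> 'v set \<Rightarrow> real" where
  "ricci_matrix E e e' =
     (if e = e' then - (\<Sum>x\<in>e. 1 / degree E x) else (\<Sum>z\<in>e \<inter> e'. 1 / degree E z))"

lemma ricci_matrix_diag:
  "x \<noteq> y \<Longrightarrow> ricci_matrix E {x, y} {x, y} = - (1 / degree E x + 1 / degree E y)"
  by (simp add: ricci_matrix_def)

lemma ricci_matrix_adjacent:
  "e \<noteq> e' \<Longrightarrow> e \<inter> e' = {z} \<Longrightarrow> ricci_matrix E e e' = 1 / degree E z"
  by (simp add: ricci_matrix_def)

lemma ricci_matrix_disjoint: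
  "e \<noteq> e' \<Longrightarrow> e \<inter> e' = {} \<Longrightarrow> ricci_matrix E e e' = 0"
  by (simp add: ricci_matrix_def)

definition eigenvector_on :: "'e set \<Rightarrow> ('e \<Rightarrow> 'e \<Rightarrow> real) \<Rightarrow> ('e \<Rightarrow> real) \<Rightarrow> real \<Rightarrow> bool" where
  "eigenvector_on I M v k \<longleftrightarrow>
     (\<exists>i\<in>I. v i \<noteq> 0) \<and> (\<forall>i\<in>I. (\<Sum>j\<in>I. M i j * v j) = k * v i)"

definition lambda_max :: "'v set set \<Rightarrow> real" where
  "lambda_max E = Max {k. \<exists>v. eigenvector_on E (ricci_matrix E) v k}"

definition perron_eigenvector :: "'v set set \<Rightarrow> ('v set \<Rightarrow> real) \<Rightarrow> bool" where
  "perron_eigenvector E w \<longleftrightarrow>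
     (\<forall>e\<in>E. 0 < w e) \<and> eigenvector_on E (ricci_matrix E) w (lambda_max E)"

(* The graph G_g: the tree vertices are tagged Inl, the cycle vertices other than v_0 are
   Inr 1, ..., Inr (g - 1), and v_0 is the root Inl r.  cycle_vertex takes indices mod g. *)
definition cycle_vertex :: "'a \<Rightarrow> nat \<Rightarrow> nat \<Rightarrow> 'a + nat" where
  "cycle_vertex r g i = (if i mod g = 0 then Inl r else Inr (i mod g))"

(* The indices 1, ..., g enumerate the cycle edges; index 0 is the same edge as index g,
   and index g + 1 the same as index 1. *)
definition cycle_edge :: "'a \<Rightarrow> nat \<Rightarrow> nat \<Rightarrow> ('a + nat) set" where
  "cycle_edge r g j = {cycle_vertex r g j, cycle_vertex r g (j + 1)}"

definition attached_verts :: "'a set \<Rightarrow> nat \<Rightarrow> ('a + nat) set" where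
  "attached_verts V g = Inl ` V \<union> Inr ` {1..<g}"

definition attached_edges :: "'a set set \<Rightarrow> 'a \<Rightarrow> nat \<Rightarrow> ('a + nat) set set" where
  "attached_edges E r g = (\<lambda>e. Inl ` e) ` E \<union> cycle_edge r g ` {1..g}"

definition cycle_length :: "'a \<Rightarrow> nat \<Rightarrow> (('a + nat) set \<Rightarrow> real) \<Rightarrow> real" where
  "cycle_length r g w = (\<Sum>j=1..g. w (cycle_edge r g j))"

(* Intended for j in {1..g}, where the truncated subtraction is harmless. *)
definition triple_weight :: "'a \<Rightarrow> nat \<Rightarrow> (('a + nat) set \<Rightarrow> real) \<Rightarrow> nat \<Rightarrow> real" where
  "triple_weight r g w j =
     w (cycle_edge r g (j - 1)) + w (cycle_edge r g j) + w (cycle_edge r g (j + 1))"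

definition max_triple_ratio :: "'a \<Rightarrow> nat \<Rightarrow> (('a + nat) set \<Rightarrow> real) \<Rightarrow> real" where
  "max_triple_ratio r g w = (MAX j\<in>{1..g}. triple_weight r g w j / cycle_length r g w)"

definition g_star :: "real \<Rightarrow> real" where
  "g_star m = (2 * m + 1) * (m - 1) / (2 * m\<^sup>2)"

definition golden_ratio :: real where
  "golden_ratio = (1 + sqrt 5) / 2"

end

theory Submission
  imports Defs
begin

text \<open>The heaviest triple consists of the two cycle edges at \<open>v_0\<close> and one edge
  next to them. For large g the cycle weights fall off from \<open>v_0\<close> on both sides like 1,
  t, t^2, ... with t = 1 / mu, so this triple weighs 2 + t out of a total of 2 / (1 - t), and
  \<open>g_star mu\<close> is (2 + t) (1 - t) / 2. It equals 1/2 exactly when t^2 + t = 1, which is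
  where the golden ratio comes from.

  The rate q depends on the eigenvalue and hence on g. A limit eigenvalue of 0 would make q tend to
  1 and flatten the profile, so the Rayleigh bound has to be uniform in g; a test weight with
  geometric decay provides this, as its norm stays bounded when the cycle grows. Positivity of the
  eigenvalue for each single g is also what makes the recurrence convex and so forces the growth of
  the antisymmetric part.

  As \<open>lambda_max\<close> is a \<open>Max\<close> over a set of reals, finiteness of that set
  and a positive eigenvector for its maximum have to be established before anything can be said
  about it.\<close>

text \<open>
  On a weight \<open>w\<close> the Ricci matrix acts by \<open>(R w) e = (\<Sum>x\<in>e. (S x - 2 w e) / d x)\<close>, where \<open>S x\<close> is the
  total weight at \<open>x\<close>. Along the cycle an eigenvector therefore satisfies
  \<open>w (c (j - 1)) + w (c (j + 1)) = 2 (1 + \<lambda>) w (c j)\<close>; its antisymmetric part would have to grow, so it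
  is a multiple of \<open>q ^ j + q ^ (g - 1 - j)\<close> with \<open>q + 1 / q = 2 (1 + \<lambda>)\<close> and \<open>q < 1\<close>. This makes the
  ratio of the statement an explicit function of \<open>g\<close> and \<open>q\<close>.

  The largest eigenvalue decreases in \<open>g\<close>, because stretching the cycle part of a Perron eigenvector
  gives a supersolution for \<open>g + 1\<close>, and a Rayleigh quotient bounds it below by a positive constant.
  Hence it converges to a positive limit.

  The curvature of an edge \<open>{x, y}\<close> equals \<open>- (R w) {x, y} / w {x, y}\<close> as soon as some
  1-Lipschitz potential increases at full slope from the neighbours of \<open>x\<close> through \<open>x\<close> and \<open>y\<close> to the
  neighbours of \<open>y\<close>. On the tree such a potential exists since there are no cycles, and around the
  cycle it exists as long as three consecutive edges make up at most half of the length.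
\<close>

section \<open>Symmetric matrices with nonnegative off-diagonal entries\<close>

definition mat_app :: "'e set \<Rightarrow> ('e \<Rightarrow> 'e \<Rightarrow> real) \<Rightarrow> ('e \<Rightarrow> real) \<Rightarrow> 'e \<Rightarrow> real" where
  "mat_app I M v i = (\<Sum>j\<in>I. M i j * v j)"

definition dot_on :: "'e set \<Rightarrow> ('e \<Rightarrow> real) \<Rightarrow> ('e \<Rightarrow> real) \<Rightarrow> real" where
  "dot_on I u v = (\<Sum>i\<in>I. u i * v i)"

lemma dot_on_commute: "dot_on I u v = dot_on I v u"
  by (simp add: dot_on_def mult.commute)

lemma mat_app_add: "mat_app I M (\<lambda>i. u i + v i) j = mat_app I M u j + mat_app I M v j"
  by (simp add: mat_app_def algebra_simps sum.distrib)

lemma mat_app_scale: "mat_app I M (\<lambda>i. c * u i) j = c * mat_app I M u j"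
  by (simp add: mat_app_def sum_distrib_left algebra_simps)

lemma dot_on_self_nonneg: "0 \<le> dot_on I u u"
  by (simp add: dot_on_def sum_nonneg)

lemma dot_on_self_pos:
  assumes "finite I" "i \<in> I" "u i \<noteq> 0"
  shows "0 < dot_on I u u"
proof -
  have "0 < u i * u i" using assms(3) by (metis not_real_square_gt_zero)
  also have "\<dots> \<le> dot_on I u u"
    unfolding dot_on_def by (rule member_le_sum) (use assms in auto)
  finally show ?thesis .
qed

lemma eigenvector_on_mat_app:
  "eigenvector_on I M v k \<longleftrightarrow> (\<exists>i\<in>I. v i \<noteq> 0) \<and> (\<forall>i\<in>I. mat_app I M v i = k * v i)"
  by (simp add: eigenvector_on_def mat_app_def)

locale sym_matrix =
  fixes I :: "'e set" and M :: "'e \<Rightarrow> 'e \<Rightarrow> real"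
  assumes fin: "finite I" and sym: "\<And>i j. M i j = M j i"
begin

lemma self_adjoint: "dot_on I u (mat_app I M v) = dot_on I (mat_app I M u) v"
proof -
  have "dot_on I u (mat_app I M v) = (\<Sum>i\<in>I. \<Sum>j\<in>I. u i * M i j * v j)"
    by (simp add: dot_on_def mat_app_def sum_distrib_left mult.assoc)
  also have "\<dots> = (\<Sum>j\<in>I. \<Sum>i\<in>I. u i * M i j * v j)" by (rule sum.swap)
  also have "\<dots> = dot_on I (mat_app I M u) v"
    unfolding dot_on_def mat_app_def sum_distrib_right
    by (intro sum.cong refl) (metis sym mult.commute)
  finally show ?thesis .
qed

lemma eigenvector_dot_pos:
  assumes "eigenvector_on I M v k"
  shows "0 < dot_on I v v"
proof -
  obtain i where "i \<in> I" "v i \<noteq> 0" using assms by (auto simp: eigenvector_on_def)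
  then show ?thesis by (rule dot_on_self_pos[OF fin])
qed

lemma eigenvectors_orthogonal:
  assumes "eigenvector_on I M u k" "eigenvector_on I M v l" "k \<noteq> l"
  shows "dot_on I u v = 0"
proof -
  have "dot_on I u (mat_app I M v) = l * dot_on I u v"
    using assms(2) by (simp add: dot_on_def eigenvector_on_mat_app sum_distrib_left algebra_simps)
  moreover have "dot_on I (mat_app I M u) v = k * dot_on I u v"
    using assms(1) by (simp add: dot_on_def eigenvector_on_mat_app sum_distrib_left algebra_simps)
  ultimately show ?thesis using assms(3) self_adjoint[of u v] by simp
qed

text \<open>Normalised eigenvectors to distinct eigenvalues are orthonormal, so by Bessel's inequality
  the squares of their \<open>i\<close>-th entries have sum at most 1; summing over \<open>i\<close> bounds their number.\<close>

lemma card_eigenvalues: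
  assumes "finite K" and "\<And>k. k \<in> K \<Longrightarrow> \<exists>v. eigenvector_on I M v k"
  shows "card K \<le> card I"
proof -
  obtain v where v: "\<And>k. k \<in> K \<Longrightarrow> eigenvector_on I M (v k) k" using assms(2) by metis
  define u where "u k i = v k i / sqrt (dot_on I (v k) (v k))" for k i
  have pos: "0 < dot_on I (v k) (v k)" if "k \<in> K" for k
    using eigenvector_dot_pos[OF v[OF that]] .
  have norm1: "dot_on I (u k) (u k) = 1" if "k \<in> K" for k
  proof -
    have "dot_on I (u k) (u k) = dot_on I (v k) (v k) / (sqrt (dot_on I (v k) (v k)))\<^sup>2"
      by (simp add: dot_on_def u_def sum_divide_distrib power2_eq_square)
    then show ?thesis using pos[OF that] by simp
  qed
  have orth: "dot_on I (u k) (u l) = 0" if "k \<in> K" "l \<in> K" "k \<noteq> l" for k l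
  proof -
    have "dot_on I (u k) (u l)
        = dot_on I (v k) (v l) / (sqrt (dot_on I (v k) (v k)) * sqrt (dot_on I (v l) (v l)))"
      by (simp add: dot_on_def u_def sum_divide_distrib)
    then show ?thesis using eigenvectors_orthogonal[OF v[OF that(1)] v[OF that(2)] that(3)] by simp
  qed
  have bessel: "(\<Sum>k\<in>K. (u k i)\<^sup>2) \<le> 1" if i: "i \<in> I" for i
  proof -
    define s where "s = (\<Sum>k\<in>K. (u k i)\<^sup>2)"
    \<comment> \<open>\<open>p\<close> is the orthogonal projection of the \<open>i\<close>-th unit
      vector to the span of the \<open>u k\<close>; both its \<open>i\<close>-th entry and its
      squared norm are \<open>s\<close>.\<close>
    define p where "p j = (\<Sum>k\<in>K. u k i * u k j)" for j
    have "dot_on I p p = (\<Sum>j\<in>I. \<Sum>k\<in>K. \<Sum>l\<in>K. u k i * u l i * (u k j * u l j))"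
      by (simp add: dot_on_def p_def sum_product algebra_simps)
    also have "\<dots> = (\<Sum>k\<in>K. \<Sum>l\<in>K. \<Sum>j\<in>I. u k i * u l i * (u k j * u l j))"
      by (subst sum.swap, rule sum.cong[OF refl], rule sum.swap)
    also have "\<dots> = (\<Sum>k\<in>K. \<Sum>l\<in>K. u k i * u l i * dot_on I (u k) (u l))"
      by (simp add: dot_on_def sum_distrib_left)
    also have "\<dots> = (\<Sum>k\<in>K. \<Sum>l\<in>K. if l = k then (u k i)\<^sup>2 else 0)"
      by (intro sum.cong refl) (auto simp: norm1 orth power2_eq_square)
    also have "\<dots> = s" using assms(1) by (simp add: s_def)
    finally have pp: "dot_on I p p = s" .
    have "p i = s" by (simp add: p_def s_def power2_eq_square)
    moreover have "(p i)\<^sup>2 \<le> dot_on I p p"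
      unfolding dot_on_def power2_eq_square by (rule member_le_sum) (use i fin in auto)
    ultimately have "s\<^sup>2 \<le> s" using pp by simp
    then have "s * (s - 1) \<le> 0" by (simp add: power2_eq_square algebra_simps)
    then have "s \<le> 1" by (auto simp: mult_le_0_iff)
    then show ?thesis by (simp add: s_def)
  qed
  have "real (card K) = (\<Sum>k\<in>K. dot_on I (u k) (u k))" using norm1 by simp
  also have "\<dots> = (\<Sum>i\<in>I. \<Sum>k\<in>K. (u k i)\<^sup>2)"
    unfolding dot_on_def power2_eq_square by (rule sum.swap)
  also have "\<dots> \<le> (\<Sum>i\<in>I. 1)" by (rule sum_mono) (rule bessel)
  finally show ?thesis by simp
qed

lemma finite_eigenvalues: "finite {k. \<exists>v. eigenvector_on I M v k}"
proof (rule ccontr)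
  assume "infinite {k. \<exists>v. eigenvector_on I M v k}"
  then obtain K where "finite K" "card K = card I + 1" "K \<subseteq> {k. \<exists>v. eigenvector_on I M v k}"
    using infinite_arbitrarily_large by blast
  then show False using card_eigenvalues[of K] by auto
qed

text \<open>Vectors are functions on a whole type. Freezing the entries outside \<open>I\<close> at
  0 and confining the others to [-1, 1] gives a product of compact sets, so Tychonoff makes the unit
  sphere compact and the quadratic form attains its maximum there; homogeneity extends the bound to
  all vectors.\<close>

lemma rayleigh_maximizer:
  assumes "I \<noteq> {}"
  obtains v where "dot_on I v v = 1"
    and "\<And>u. dot_on I u (mat_app I M u) \<le> dot_on I v (mat_app I M v) * dot_on I u u"
proof -
  define B where "B i = (if i \<in> I then {-1..1::real} else {0})" for i
  define K where "K = (\<Pi>\<^sub>E i\<in>UNIV. B i) \<inter> (\<lambda>v. dot_on I v v) -` {1}"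
  have "compactin (product_topology (\<lambda>_. euclidean) UNIV) (\<Pi>\<^sub>E i\<in>UNIV. B i)"
    unfolding compactin_PiE by (simp add: B_def)
  then have cB: "compact (\<Pi>\<^sub>E i\<in>UNIV. B i)"
    by (simp add: euclidean_product_topology flip: compactin_euclidean_iff)
  have cont_dot: "continuous_on UNIV (\<lambda>v. dot_on I v v)"
    unfolding dot_on_def by (intro continuous_intros) auto
  have cont_form: "continuous_on K (\<lambda>v. dot_on I v (mat_app I M v))"
    unfolding dot_on_def mat_app_def
    by (intro continuous_intros) (auto intro: continuous_on_subset[OF continuous_on_product_coordinates])
  have "closed ((\<lambda>v. dot_on I v v) -` {1})"
    by (rule closed_vimage[OF _ cont_dot]) simp
  then have cK: "compact K" unfolding K_def by (rule compact_Int_closed[OF cB])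
  have scaled: "\<exists>u'\<in>K. \<forall>i\<in>I. u i = sqrt (dot_on I u u) * u' i" if "i \<in> I" "u i \<noteq> 0" for u i
  proof -
    define c where "c = sqrt (dot_on I u u)"
    have pos: "0 < dot_on I u u" using fin that by (rule dot_on_self_pos)
    then have c: "0 < c" "c\<^sup>2 = dot_on I u u" by (simp_all add: c_def)
    define u' where "u' j = (if j \<in> I then u j / c else 0)" for j
    have "dot_on I u' u' = dot_on I u u / c\<^sup>2"
      by (simp add: dot_on_def u'_def sum_divide_distrib power2_eq_square)
    then have one: "dot_on I u' u' = 1" using c pos by simp
    have bound: "\<bar>u' j\<bar> \<le> 1" if "j \<in> I" for j
    proof -
      have "u' j * u' j \<le> dot_on I u' u'"
        unfolding dot_on_def by (rule member_le_sum) (use that fin in auto)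
      then show ?thesis using one by (simp add: abs_square_le_1 flip: power2_eq_square)
    qed
    then have "u' j \<in> B j" for j
    proof (cases "j \<in> I")
      case True
      then show ?thesis using bound[OF True] by (simp add: B_def abs_le_iff minus_le_iff)
    next
      case False
      then show ?thesis by (simp add: B_def u'_def)
    qed
    then have "u' \<in> K" using one by (simp add: K_def PiE_UNIV_domain Pi_def)
    moreover have "\<forall>i\<in>I. u i = c * u' i" using c by (simp add: u'_def)
    ultimately show ?thesis unfolding c_def by blast
  qed
  obtain i0 where "i0 \<in> I" using assms by blast
  then have "K \<noteq> {}" using scaled[of i0 "\<lambda>_. 1"] by auto
  then obtain v where v: "v \<in> K"
    and vmax: "\<And>u. u \<in> K \<Longrightarrow> dot_on I u (mat_app I M u) \<le> dot_on I v (mat_app I M v)"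
    using continuous_attains_sup[OF cK _ cont_form] by auto
  have le: "dot_on I u (mat_app I M u) \<le> dot_on I v (mat_app I M v) * dot_on I u u" for u
  proof (cases "\<exists>i\<in>I. u i \<noteq> 0")
    case True
    then obtain i where "i \<in> I" "u i \<noteq> 0" by blast
    from scaled[of i u, OF this] obtain u'
      where u': "u' \<in> K" "\<And>i. i \<in> I \<Longrightarrow> u i = sqrt (dot_on I u u) * u' i" by blast
    have "dot_on I u (mat_app I M u) = c\<^sup>2 * dot_on I u' (mat_app I M u')"
      if "\<And>i. i \<in> I \<Longrightarrow> u i = c * u' i" for c
      using that by (simp add: dot_on_def mat_app_def sum_distrib_left power2_eq_square algebra_simps)
    from this[OF u'(2)]
    have "dot_on I u (mat_app I M u) = (sqrt (dot_on I u u))\<^sup>2 * dot_on I u' (mat_app I M u')" .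
    also have "\<dots> = dot_on I u u * dot_on I u' (mat_app I M u')"
      by (simp add: dot_on_self_nonneg)
    also have "\<dots> \<le> dot_on I u u * dot_on I v (mat_app I M v)"
      by (rule mult_left_mono[OF vmax[OF u'(1)] dot_on_self_nonneg])
    finally show ?thesis by (simp add: mult.commute)
  next
    case False
    then show ?thesis by (simp add: dot_on_def)
  qed
  from v have "dot_on I v v = 1" by (simp add: K_def)
  with le show ?thesis using that by blast
qed

text \<open>First variation in the direction of the residual \<open>u\<close>: at v + t u the
  assumed bound reads 2 |u|^2 + t c \<le> 0 after division by t, and small t forces u = 0.\<close>

lemma maximizer_eigenvector:
  assumes "\<And>u. dot_on I u (mat_app I M u) \<le> k * dot_on I u u"
    and "dot_on I v (mat_app I M v) = k * dot_on I v v" and i: "i \<in> I"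
  shows "mat_app I M v i = k * v i"
proof -
  define u where "u j = mat_app I M v j - k * v j" for j
  define c where "c = dot_on I u (mat_app I M u) - k * dot_on I u u"
  have uu: "dot_on I u u = dot_on I u (mat_app I M v) - k * dot_on I u v"
  proof -
    have "dot_on I u (\<lambda>j. mat_app I M v j - k * v j) = dot_on I u (mat_app I M v) - k * dot_on I u v"
      by (simp add: dot_on_def algebra_simps sum_subtractf sum_distrib_left)
    then show ?thesis by (simp add: u_def[abs_def])
  qed
  have key: "2 * dot_on I u u + t * c \<le> 0" if "t > 0" for t
  proof -
    have app: "mat_app I M (\<lambda>i. v i + t * u i) = (\<lambda>i. mat_app I M v i + t * mat_app I M u i)"
      by (rule ext) (simp add: mat_app_add mat_app_scale)
    have expand: "dot_on I (\<lambda>i. v i + t * u i) (\<lambda>i. x i + t * y i)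
        = dot_on I v x + t * dot_on I u x + t * dot_on I v y + t * t * dot_on I u y" for x y
      by (simp add: dot_on_def sum.distrib sum_distrib_left algebra_simps)
    have "dot_on I v (mat_app I M u) = dot_on I u (mat_app I M v)"
      by (metis self_adjoint dot_on_commute)
    moreover have "dot_on I v u = dot_on I u v" by (rule dot_on_commute)
    ultimately have "t * (2 * dot_on I u u + t * c) \<le> 0"
      using assms(1)[of "\<lambda>i. v i + t * u i"] assms(2) unfolding app expand uu c_def
      by (simp add: algebra_simps)
    then show ?thesis using that by (simp add: mult_le_0_iff)
  qed
  have "dot_on I u u \<le> 0"
  proof (rule ccontr)
    assume "\<not> dot_on I u u \<le> 0"
    then have p: "dot_on I u u > 0" by simp
    \<comment> \<open>Small enough that the second-order term t c cannot outweigh half of 2 |u|^2;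
      the summand 1 covers c = 0.\<close>
    define t where "t = dot_on I u u / (\<bar>c\<bar> + 1)"
    have t: "0 < t" using p by (simp add: t_def)
    have "t * \<bar>c\<bar> \<le> t * (\<bar>c\<bar> + 1)" using t by simp
    also have "\<dots> = dot_on I u u" unfolding t_def using abs_ge_zero[of c] by (simp add: field_simps)
    finally have "\<bar>t * c\<bar> \<le> dot_on I u u" using t by (simp add: abs_mult)
    then show False using key[OF t] p by linarith
  qed
  then have "u i = 0" using dot_on_self_pos[OF fin i, of u] by force
  then show ?thesis by (simp add: u_def)
qed

end

section \<open>Perron-Frobenius theory for irreducible symmetric matrices\<close>

locale perron_matrix = sym_matrix +
  assumes nonempty: "I \<noteq> {}"
    and offdiag: "\<And>i j. i \<in> I \<Longrightarrow> j \<in> I \<Longrightarrow> i \<noteq> j \<Longrightarrow> 0 \<le> M i j"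
    and irreducible: "\<And>S. S \<subset> I \<Longrightarrow> S \<noteq> {} \<Longrightarrow> \<exists>i\<in>S. \<exists>j\<in>I - S. 0 < M i j"
begin

definition top_eigenvalue :: real where
  "top_eigenvalue = Max {k. \<exists>v. eigenvector_on I M v k}"

text \<open>Otherwise irreducibility yields a zero entry linked to a positive one; in the
  eigenvector equation at the zero entry one side is positive and the other is 0.\<close>

lemma nonneg_eigenvector_pos:
  assumes ev: "eigenvector_on I M v k" and nn: "\<And>i. i \<in> I \<Longrightarrow> 0 \<le> v i" and "i \<in> I"
  shows "0 < v i"
proof (rule ccontr)
  assume "\<not> 0 < v i"
  define S where "S = {j \<in> I. v j = 0}"
  have "i \<in> S" using \<open>\<not> 0 < v i\<close> nn[OF \<open>i \<in> I\<close>] \<open>i \<in> I\<close> by (simp add: S_def)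
  moreover have "S \<subset> I" using ev by (auto simp: S_def eigenvector_on_def)
  ultimately obtain a b where ab: "a \<in> S" "b \<in> I - S" "0 < M a b" using irreducible[of S] by blast
  have nn_prod: "0 \<le> M a j * v j" if "j \<in> I" for j
    using ab(1) offdiag[of a j] nn[OF that] that by (cases "j = a") (auto simp: S_def)
  have "0 < M a b * v b" using ab nn[of b] by (auto simp: S_def less_le)
  also have "\<dots> \<le> mat_app I M v a"
    unfolding mat_app_def by (rule member_le_sum) (use ab fin nn_prod in auto)
  also have "\<dots> = 0" using ev ab(1) by (simp add: eigenvector_on_mat_app S_def)
  finally show False by simp
qed

text \<open>Taking absolute values leaves the diagonal part of the quadratic form unchanged and
  cannot decrease the off-diagonal part. So the absolute value of a maximizer is again one, hence a
  nonnegative eigenvector, hence a positive one.\<close>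

lemma
  shows top_exists: "\<exists>v. (\<forall>i\<in>I. 0 < v i) \<and> eigenvector_on I M v top_eigenvalue"
    and rayleigh: "dot_on I u (mat_app I M u) \<le> top_eigenvalue * dot_on I u u"
proof -
  obtain v where v1: "dot_on I v v = 1"
    and vmax: "\<And>u. dot_on I u (mat_app I M u) \<le> dot_on I v (mat_app I M v) * dot_on I u u"
    using rayleigh_maximizer[OF nonempty] by blast
  define k where "k = dot_on I v (mat_app I M v)"
  define a where "a i = \<bar>v i\<bar>" for i
  have aa: "dot_on I a a = 1" using v1 by (simp add: dot_on_def a_def)
  have "k \<le> dot_on I a (mat_app I M a)"
    unfolding k_def dot_on_def mat_app_def sum_distrib_left
  proof (intro sum_mono)
    fix i j assume ij: "i \<in> I" "j \<in> I"
    show "v i * (M i j * v j) \<le> a i * (M i j * a j)"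
    proof (cases "i = j")
      case True
      then show ?thesis by (simp add: a_def mult.left_commute)
    next
      case False
      then have "v i * v j * M i j \<le> a i * a j * M i j"
        using offdiag[OF ij] by (intro mult_right_mono) (auto simp: a_def simp flip: abs_mult)
      then show ?thesis by (simp add: algebra_simps)
    qed
  qed
  then have "dot_on I a (mat_app I M a) = k * dot_on I a a"
    using vmax[of a] aa by (simp add: k_def)
  then have "\<forall>i\<in>I. mat_app I M a i = k * a i"
    using maximizer_eigenvector[of k a] vmax by (simp add: k_def)
  moreover have "\<exists>i\<in>I. a i \<noteq> 0"
  proof (rule ccontr)
    assume "\<not> (\<exists>i\<in>I. a i \<noteq> 0)"
    then have "dot_on I a a = 0" by (simp add: dot_on_def)
    then show False using aa by simp
  qed
  ultimately have ev: "eigenvector_on I M a k" by (simp add: eigenvector_on_mat_app)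
  have "l \<le> k" if "eigenvector_on I M u l" for u l
  proof -
    have "0 < dot_on I u u" by (rule eigenvector_dot_pos[OF that])
    moreover have "dot_on I u (mat_app I M u) = l * dot_on I u u"
      using that by (simp add: dot_on_def eigenvector_on_mat_app sum_distrib_left algebra_simps)
    ultimately show ?thesis using vmax[of u] by (simp add: k_def)
  qed
  then have "top_eigenvalue = k"
    unfolding top_eigenvalue_def using ev by (intro Max_eqI finite_eigenvalues) auto
  moreover have "\<forall>i\<in>I. 0 < a i" using nonneg_eigenvector_pos[OF ev] by (simp add: a_def)
  ultimately show "\<exists>v. (\<forall>i\<in>I. 0 < v i) \<and> eigenvector_on I M v top_eigenvalue"
    and "dot_on I u (mat_app I M u) \<le> top_eigenvalue * dot_on I u u"
    using ev vmax[of u] by (auto simp: k_def)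
qed

text \<open>Collatz-Wielandt bound: pairing \<open>u\<close> with the positive top eigenvector and
  moving the matrix to the other side turns the pointwise inequalities into a single one between the
  eigenvalues.\<close>

lemma top_eigenvalue_le:
  assumes pos: "\<And>i. i \<in> I \<Longrightarrow> 0 < u i" and le: "\<And>i. i \<in> I \<Longrightarrow> mat_app I M u i \<le> k * u i"
  shows "top_eigenvalue \<le> k"
proof -
  obtain v where v: "\<forall>i\<in>I. 0 < v i" "eigenvector_on I M v top_eigenvalue" using top_exists by blast
  have "top_eigenvalue * dot_on I u v = dot_on I u (mat_app I M v)"
    using v(2) by (simp add: dot_on_def eigenvector_on_mat_app sum_distrib_left algebra_simps)
  also have "\<dots> = dot_on I (mat_app I M u) v" by (rule self_adjoint)
  also have "\<dots> \<le> (\<Sum>i\<in>I. k * u i * v i)"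
    unfolding dot_on_def using le v(1) by (intro sum_mono mult_right_mono) (auto simp: less_imp_le)
  also have "\<dots> = k * dot_on I u v" by (simp add: dot_on_def sum_distrib_left mult.assoc)
  finally have "top_eigenvalue * dot_on I u v \<le> k * dot_on I u v" .
  moreover have "0 < dot_on I u v"
    unfolding dot_on_def using pos v(1) fin nonempty by (intro sum_pos) auto
  ultimately show ?thesis by simp
qed

end

section \<open>Graphs\<close>

lemma simple_graphD:
  assumes "simple_graph V E"
  shows "finite V" "finite E" "{a, b} \<in> E \<Longrightarrow> a \<in> V" "{a, b} \<in> E \<Longrightarrow> b \<in> V"
    "{a, b} \<in> E \<Longrightarrow> a \<noteq> b" "e \<in> E \<Longrightarrow> \<exists>a b. a \<noteq> b \<and> e = {a, b}" "e \<in> E \<Longrightarrow> finite e"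
proof -
  have "E \<subseteq> Pow V" using assms by (auto simp: simple_graph_def)
  then show "finite E" using assms by (meson finite_Pow_iff finite_subset simple_graph_def)
  show "{a, b} \<in> E \<Longrightarrow> a \<noteq> b" using assms by (fastforce simp: simple_graph_def doubleton_eq_iff)
qed (use assms in \<open>fastforce simp: simple_graph_def doubleton_eq_iff\<close>)+

lemma bij_betw_incident:
  assumes "simple_graph V E"
  shows "bij_betw (\<lambda>y. {x, y}) (neighbours E x) {e \<in> E. x \<in> e}"
  unfolding bij_betw_def
proof
  show "inj_on (\<lambda>y. {x, y}) (neighbours E x)"
    by (auto simp: inj_on_def doubleton_eq_iff)
  show "(\<lambda>y. {x, y}) ` neighbours E x = {e \<in> E. x \<in> e}"
  proof
    show "{e \<in> E. x \<in> e} \<subseteq> (\<lambda>y. {x, y}) ` neighbours E x"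
    proof
      fix e assume e: "e \<in> {e \<in> E. x \<in> e}"
      then obtain a b where "e = {a, b}" using simple_graphD(6)[OF assms] by blast
      then obtain y where "e = {x, y}" using e by fastforce
      then show "e \<in> (\<lambda>y. {x, y}) ` neighbours E x" using e by (auto simp: neighbours_def)
    qed
  qed (auto simp: neighbours_def)
qed

lemma degree_eq_card_incident:
  "simple_graph V E \<Longrightarrow> degree E x = card {e \<in> E. x \<in> e}"
  unfolding degree_def by (rule bij_betw_same_card[OF bij_betw_incident])

lemma sum_incident:
  "simple_graph V E \<Longrightarrow> (\<Sum>e\<in>{e \<in> E. x \<in> e}. w e) = (\<Sum>y\<in>neighbours E x. w {x, y})"
  by (rule sum.reindex_bij_betw[OF bij_betw_incident, symmetric])

lemma degree_pos:
  assumes "simple_graph V E" "e \<in> E" "x \<in> e"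
  shows "0 < degree E x"
  using assms simple_graphD(2)[OF assms(1)]
  by (auto simp: degree_eq_card_incident[OF assms(1)] card_gt_0_iff)

lemma ricci_matrix_sym: "ricci_matrix E e e' = ricci_matrix E e' e"
  by (simp add: ricci_matrix_def Int_commute)

lemma ricci_app:
  assumes G: "simple_graph V E" and e: "e \<in> E"
  shows "mat_app E (ricci_matrix E) w e =
    (\<Sum>x\<in>e. ((\<Sum>e'\<in>{e' \<in> E. x \<in> e'}. w e') - 2 * w e) / degree E x)"
proof -
  have fE: "finite E" and fe: "finite e" using simple_graphD[OF G] e by auto
  \<comment> \<open>The diagonal contribution -1/d is split as 1/d - 2/d, so that \<open>e\<close>
    itself is counted among the edges at each of its ends.\<close>
  have "ricci_matrix E e e' * w e' = (\<Sum>x\<in>e. (if x \<in> e' then w e' / degree E x else 0))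
      - (if e' = e then (\<Sum>x\<in>e. 2 * w e / degree E x) else 0)" for e'
  proof (cases "e = e'")
    case True
    then show ?thesis
      by (simp add: ricci_matrix_def sum_distrib_right flip: sum_subtractf sum_negf)
  next
    case False
    then show ?thesis
      by (simp add: ricci_matrix_def sum_distrib_right sum.inter_restrict[OF fe])
        (intro sum.cong, auto)
  qed
  then have "mat_app E (ricci_matrix E) w e =
      (\<Sum>e'\<in>E. \<Sum>x\<in>e. (if x \<in> e' then w e' / degree E x else 0)) - (\<Sum>x\<in>e. 2 * w e / degree E x)"
    using fE e by (simp add: mat_app_def sum_subtractf)
  also have "(\<Sum>e'\<in>E. \<Sum>x\<in>e. (if x \<in> e' then w e' / degree E x else 0))
      = (\<Sum>x\<in>e. \<Sum>e'\<in>E. (if x \<in> e' then w e' / degree E x else 0))" by (rule sum.swap)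
  also have "\<dots> = (\<Sum>x\<in>e. (\<Sum>e'\<in>{e' \<in> E. x \<in> e'}. w e') / degree E x)"
    by (intro sum.cong refl)
      (auto simp: sum_divide_distrib sum.inter_filter[OF fE] intro!: sum.cong)
  finally show ?thesis by (simp add: diff_divide_distrib sum_subtractf)
qed

subsection \<open>Walks and paths\<close>

definition adj :: "'v set set \<Rightarrow> ('v \<times> 'v) set" where
  "adj E = {(a, b). {a, b} \<in> E}"

lemma adj_sym: "(a, b) \<in> (adj E)\<^sup>* \<Longrightarrow> (b, a) \<in> (adj E)\<^sup>*"
  by (rule symD[OF sym_rtrancl]) (auto simp: sym_def adj_def insert_commute)

lemma rtrancl_adj_of_path:
  assumes "successively (\<lambda>a b. {a, b} \<in> E) p" "p \<noteq> []"
  shows "(hd p, last p) \<in> (adj E)\<^sup>*"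
  using assms
proof (induction p rule: induct_list012)
  case (3 a b p)
  then have "(a, b) \<in> adj E" "(b, last (b # p)) \<in> (adj E)\<^sup>*" by (auto simp: adj_def)
  then show ?case by (simp add: converse_rtrancl_into_rtrancl)
qed auto

text \<open>Loop erasure: a walk that returns to a visited vertex is cut back to its first visit.
  The start \<open>a\<close> is listed separately because it may lie on no edge.\<close>

lemma path_of_rtrancl_adj:
  assumes "(a, b) \<in> (adj E)\<^sup>*"
  shows "\<exists>p. p \<noteq> [] \<and> hd p = a \<and> last p = b \<and> distinct p \<and> set p \<subseteq> insert a (\<Union>E)
    \<and> successively (\<lambda>a b. {a, b} \<in> E) p"
  using assms
proof (induction rule: rtrancl_induct)
  case base
  then show ?case by (intro exI[of _ "[a]"]) auto
next
  case (step b c)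
  then obtain p where p: "p \<noteq> []" "hd p = a" "last p = b" "distinct p" "set p \<subseteq> insert a (\<Union>E)"
    "successively (\<lambda>a b. {a, b} \<in> E) p" by blast
  have bc: "{b, c} \<in> E" using step.hyps by (simp add: adj_def)
  show ?case
  proof (cases "c \<in> set p")
    case True
    then obtain us vs where us: "p = us @ c # vs" by (meson split_list)
    then have "hd (us @ [c]) = a" using p(2) by (cases us) auto
    moreover have "successively (\<lambda>a b. {a, b} \<in> E) (us @ [c])"
      using p(6) us by (simp add: successively_append_iff)
    ultimately show ?thesis using p us by (intro exI[of _ "us @ [c]"]) auto
  next
    case False
    have "c \<in> \<Union>E" using bc by blast
    then show ?thesis using p False bc
      by (intro exI[of _ "p @ [c]"]) (auto simp: successively_append_iff)
  qed
qed

text \<open>Reachability admits induction along a walk without tracking distinctness of the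
  vertices.\<close>

lemma connected_graph_iff:
  assumes "simple_graph V E"
  shows "connected_graph V E \<longleftrightarrow> V \<noteq> {} \<and> (\<forall>a\<in>V. \<forall>b\<in>V. (a, b) \<in> (adj E)\<^sup>*)"
proof -
  have sub: "\<Union>E \<subseteq> V" using assms by (auto simp: simple_graph_def)
  have "paths V E a b \<noteq> {} \<longleftrightarrow> (a, b) \<in> (adj E)\<^sup>*" if ab: "a \<in> V" "b \<in> V" for a b
  proof
    assume "paths V E a b \<noteq> {}"
    then show "(a, b) \<in> (adj E)\<^sup>*" using rtrancl_adj_of_path by (fastforce simp: paths_def)
  next
    assume "(a, b) \<in> (adj E)\<^sup>*"
    from path_of_rtrancl_adj[OF this] obtain p where p: "p \<noteq> []" "hd p = a" "last p = b"
      "distinct p" "set p \<subseteq> insert a (\<Union>E)" "successively (\<lambda>a b. {a, b} \<in> E) p" by blast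
    moreover have "set p \<subseteq> V" using p(5) ab(1) sub by auto
    ultimately show "paths V E a b \<noteq> {}" by (auto simp: paths_def)
  qed
  then show ?thesis by (auto simp: connected_graph_def)
qed

text \<open>A breadth-first search assigns to every vertex except the root the edge to its parent, and
  distinct vertices get distinct edges.\<close>

lemma card_verts_le_card_edges:
  assumes G: "simple_graph V E" and conn: "connected_graph V E"
  shows "card V \<le> card E + 1"
proof -
  obtain r where r: "r \<in> V" using conn by (auto simp: connected_graph_def)
  define depth where "depth v = (LEAST n. (r, v) \<in> adj E ^^ n)" for v
  have depth: "(r, v) \<in> adj E ^^ depth v" if "v \<in> V" for v
  proof -
    have "(r, v) \<in> (adj E)\<^sup>*" using conn r that connected_graph_iff[OF G] by blast
    then obtain n where "(r, v) \<in> adj E ^^ n" using rtrancl_imp_relpow by blast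
    then show ?thesis unfolding depth_def by (rule LeastI)
  qed
  have "\<exists>u. {u, v} \<in> E \<and> depth u < depth v" if v: "v \<in> V - {r}" for v
  proof -
    have "depth v \<noteq> 0" using depth[of v] v by (auto intro: ccontr)
    then obtain n where n: "depth v = Suc n" by (cases "depth v") auto
    then have "(r, v) \<in> adj E ^^ n O adj E" using depth[of v] v by simp
    then obtain u where u: "(r, u) \<in> adj E ^^ n" "{u, v} \<in> E" by (auto simp: adj_def)
    from u(1) have "depth u \<le> n" unfolding depth_def by (rule Least_le)
    then show ?thesis using u(2) n by auto
  qed
  then obtain par where par: "\<And>v. v \<in> V - {r} \<Longrightarrow> {par v, v} \<in> E \<and> depth (par v) < depth v" by metis
  have "inj_on (\<lambda>v. {par v, v}) (V - {r})"
  proof (rule inj_onI)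
    fix u v assume uv: "u \<in> V - {r}" "v \<in> V - {r}" "{par u, u} = {par v, v}"
    show "u = v"
    proof (rule ccontr)
      assume "u \<noteq> v"
      \<comment> \<open>Each would be the parent of the other and thus of smaller depth.\<close>
      then have "par u = v" "par v = u" using uv(3) by (auto simp: doubleton_eq_iff)
      then show False using par[OF uv(1)] par[OF uv(2)] by simp
    qed
  qed
  moreover have "(\<lambda>v. {par v, v}) ` (V - {r}) \<subseteq> E" using par by auto
  ultimately have "card (V - {r}) \<le> card E"
    using card_inj_on_le simple_graphD(2)[OF G] by blast
  then show ?thesis using r simple_graphD(1)[OF G] by (simp add: card_Diff_singleton)
qed

lemma perron_matrix_ricci:
  assumes G: "simple_graph V E" and conn: "connected_graph V E" and ne: "E \<noteq> {}"
  shows "perron_matrix E (ricci_matrix E)"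
proof
  show "finite E" by (rule simple_graphD(2)[OF G])
  show "E \<noteq> {}" by (rule ne)
  show "ricci_matrix E e e' = ricci_matrix E e' e" for e e' by (rule ricci_matrix_sym)
  show "0 \<le> ricci_matrix E e e'" if "e \<noteq> e'" for e e'
    using that by (auto simp: ricci_matrix_def intro: sum_nonneg)
  fix S assume S: "S \<subset> E" "S \<noteq> {}"
  have "\<exists>e\<in>S. \<exists>e'\<in>E - S. e \<inter> e' \<noteq> {}"
  proof (rule ccontr)
    assume no: "\<not> ?thesis"
    \<comment> \<open>If no edge of \<open>S\<close> met an edge outside \<open>S\<close>, the
      vertices covered by \<open>S\<close> would be closed under adjacency, and connectivity would
      carry them to an end of an edge outside \<open>S\<close>.\<close>
    have closed: "b \<in> \<Union>S" if "(a, b) \<in> (adj E)\<^sup>*" "a \<in> \<Union>S" for a b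
      using that(1)
    proof (induction rule: rtrancl_induct)
      case (step y z)
      then obtain e where "e \<in> S" "y \<in> e" by blast
      moreover have "{y, z} \<in> E" using step.hyps by (simp add: adj_def)
      ultimately have "{y, z} \<in> S" using no by blast
      then show ?case by blast
    qed (use that in simp)
    obtain e e' where e: "e \<in> S" "e' \<in> E - S" using S by blast
    have "e \<in> E" "e' \<in> E" using e S by auto
    then obtain a b where ab: "a \<in> e" "b \<in> e'" "a \<in> V" "b \<in> V"
      using G unfolding simple_graph_def by (metis insertI1)
    have "(a, b) \<in> (adj E)\<^sup>*" using conn ab connected_graph_iff[OF G] by blast
    then have "b \<in> \<Union>S" using closed ab(1) e(1) by blast
    then show False using no e(2) ab(2) by blast
  qed
  then obtain e e' z where e: "e \<in> S" "e' \<in> E - S" "z \<in> e \<inter> e'" by blast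
  have eE: "e \<in> E" using e S by blast
  have "0 < 1 / real (degree E z)" using degree_pos[OF G eE] e(3) by simp
  also have "\<dots> \<le> (\<Sum>z\<in>e \<inter> e'. 1 / real (degree E z))"
    using simple_graphD(7)[OF G eE] e(3) by (intro member_le_sum) auto
  also have "\<dots> = ricci_matrix E e e'" using e by (auto simp: ricci_matrix_def)
  finally show "\<exists>i\<in>S. \<exists>j\<in>E - S. 0 < ricci_matrix E i j" using e by blast
qed

lemma lambda_max_eq_top:
  "perron_matrix E (ricci_matrix E) \<Longrightarrow>
    lambda_max E = perron_matrix.top_eigenvalue E (ricci_matrix E)"
  by (simp add: lambda_max_def perron_matrix.top_eigenvalue_def)

subsection \<open>Potentials on acyclic graphs\<close>

text \<open>Insert the edges one by one. A new edge {u, v} that closes no cycle joins two different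
  components, so shifting the potential by a constant on the component of \<open>v\<close> fits the
  new edge and disturbs none of the old increments.\<close>

lemma acyclic_potential:
  fixes d :: "'v \<Rightarrow> 'v \<Rightarrow> real"
  assumes "finite E" and "\<not> has_cycle E" and "\<And>e. e \<in> E \<Longrightarrow> \<exists>a b. a \<noteq> b \<and> e = {a, b}"
    and anti: "\<And>a b. d b a = - d a b"
  shows "\<exists>h. \<forall>a b. {a, b} \<in> E \<longrightarrow> h b - h a = d a b"
  using assms(1-3)
proof (induction E rule: finite_induct)
  case empty
  then show ?case by simp
next
  case (insert e E)
  obtain u v where uv: "u \<noteq> v" "e = {u, v}" using insert.prems(2) by blast
  have mono: "successively (\<lambda>a b. {a, b} \<in> insert e E) p" if "successively (\<lambda>a b. {a, b} \<in> E) p" for p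
    using that by (rule successively_mono) auto
  have "\<not> has_cycle E"
    using insert.prems(1) mono unfolding has_cycle_def by (metis insertI2)
  then obtain h where h: "\<And>a b. {a, b} \<in> E \<Longrightarrow> h b - h a = d a b"
    using insert.IH insert.prems(2) by (metis insertI2)
  define C where "C = {x. (v, x) \<in> (adj E)\<^sup>*}"
  have "u \<notin> C"
  proof
    assume "u \<in> C"
    then have "(v, u) \<in> (adj E)\<^sup>*" by (simp add: C_def)
    from path_of_rtrancl_adj[OF this] obtain p where p: "p \<noteq> []" "hd p = v" "last p = u"
      "distinct p" "successively (\<lambda>a b. {a, b} \<in> E) p" by blast
    \<comment> \<open>A shorter path from \<open>v\<close> to \<open>u\<close> would be a single
      vertex or the new edge itself.\<close>
    have "length p \<ge> 3"
    proof (rule ccontr)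
      assume "\<not> 3 \<le> length p"
      then consider "p = [v]" | x where "p = [v, x]"
        using p(1,2) by (cases p; cases "tl p"; cases "tl (tl p)") auto
      then show False using p uv insert.hyps(2) by cases (auto simp: insert_commute)
    qed
    moreover have "{last p, hd p} \<in> insert e E" using p uv by simp
    ultimately have "has_cycle (insert e E)"
      unfolding has_cycle_def using p(4) mono[OF p(5)] by blast
    then show False using insert.prems(1) by simp
  qed
  define h' where "h' x = (if x \<in> C then h x + (h u + d u v - h v) else h x)" for x
  have "v \<in> C" by (simp add: C_def)
  have same: "a \<in> C \<longleftrightarrow> b \<in> C" if "{a, b} \<in> E" for a b
  proof -
    have "(a, b) \<in> adj E" "(b, a) \<in> adj E" using that by (auto simp: adj_def insert_commute)
    then show ?thesis unfolding C_def by (auto intro: rtrancl_into_rtrancl)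
  qed
  have "h' b - h' a = d a b" if "{a, b} \<in> insert e E" for a b
  proof (cases "{a, b} \<in> E")
    case True
    then show ?thesis using h[OF True] same[OF True] by (simp add: h'_def)
  next
    case False
    then have "(a = u \<and> b = v) \<or> (a = v \<and> b = u)" using that uv by (auto simp: doubleton_eq_iff)
    then show ?thesis using \<open>u \<notin> C\<close> \<open>v \<in> C\<close> anti[of u v] by (auto simp: h'_def)
  qed
  then show ?case by blast
qed

section \<open>Curvature from a potential\<close>

lemma path_weight_Cons2: "path_weight w (a # b # p) = w {a, b} + path_weight w (b # p)"
  by (simp add: path_weight_def)

lemma finite_paths: "finite V \<Longrightarrow> finite (paths V E a b)"
  by (rule finite_subset[OF _ finite_subset_distinct[of V]]) (auto simp: paths_def)

lemma weighted_dist_le: "finite V \<Longrightarrow> p \<in> paths V E a b \<Longrightarrow> weighted_dist V E w a b \<le> path_weight w p"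
  unfolding weighted_dist_def by (intro Min_le finite_imageI finite_paths imageI)

lemma weighted_dist_ge:
  assumes V: "finite V" and ne: "paths V E a b \<noteq> {}"
    and lip: "\<And>u v. {u, v} \<in> E \<Longrightarrow> f v - f u \<le> w {u, v}"
  shows "f b - f a \<le> weighted_dist V E w a b"
proof -
  have tele: "f (last p) - f (hd p) \<le> path_weight w p"
    if "successively (\<lambda>a b. {a, b} \<in> E) p" "p \<noteq> []" for p
    using that
  proof (induction p rule: induct_list012)
    case (3 u v p)
    then show ?case using lip[of u v] by (simp add: path_weight_Cons2 split: if_splits)
  qed (auto simp: path_weight_def)
  have "weighted_dist V E w a b \<in> path_weight w ` paths V E a b"
    unfolding weighted_dist_def using V ne by (intro Min_in finite_imageI finite_paths) auto
  then show ?thesis using tele by (auto simp: paths_def)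
qed

lemma finite_neighbours: "simple_graph V E \<Longrightarrow> finite (neighbours E x)"
  by (rule finite_subset[of _ V]) (auto simp: neighbours_def dest: simple_graphD)

lemma expectation_lazy_measure:
  assumes G: "simple_graph V E" and ne: "neighbours E x \<noteq> {}" and a: "0 \<le> a" "a \<le> 1"
  shows "measure_pmf.expectation (lazy_measure E a x) f
    = a * f x + (1 - a) * ((\<Sum>z\<in>neighbours E x. f z) / degree E x)"
proof -
  have x: "x \<notin> neighbours E x" using simple_graphD(5)[OF G, of x x] by (auto simp: neighbours_def)
  note pmf = pmf_lazy_measure[OF G ne a]
  have "measure_pmf.expectation (lazy_measure E a x) f
      = (\<Sum>z\<in>insert x (neighbours E x). f z * pmf (lazy_measure E a x) z)"
    by (rule integral_measure_pmf_real)
      (use finite_neighbours[OF G] in \<open>auto simp: set_pmf_iff pmf split: if_splits\<close>)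
  also have "\<dots> = f x * a + (\<Sum>z\<in>neighbours E x. f z * pmf (lazy_measure E a x) z)"
    using x finite_neighbours[OF G] by (simp add: pmf)
  also have "(\<Sum>z\<in>neighbours E x. f z * pmf (lazy_measure E a x) z)
      = (\<Sum>z\<in>neighbours E x. f z * ((1 - a) / degree E x))"
    using x by (intro sum.cong refl) (auto simp: pmf)
  finally show ?thesis by (simp add: sum_distrib_left sum_divide_distrib mult.commute)
qed

lemma set_pmf_lazy_measure:
  assumes "simple_graph V E" "neighbours E x \<noteq> {}"
  shows "set_pmf (lazy_measure E a x) \<subseteq> insert x (neighbours E x)"
  using set_pmf_of_set[OF assms(2) finite_neighbours[OF assms(1)]]
  by (auto simp: lazy_measure_def split: if_splits)

text \<open>With probability \<open>p\<close> only the first walker moves, with probability \<open>p\<close> only the second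
  one, so the pair \<open>(y, x)\<close>, the only one along which mass would travel backwards, has
  probability 0.\<close>

definition jump_coupling :: "'v set set \<Rightarrow> real \<Rightarrow> 'v \<Rightarrow> 'v \<Rightarrow> ('v \<times> 'v) pmf" where
  "jump_coupling E p x y = bind_pmf (bernoulli_pmf (2 * p)) (\<lambda>move.
     if move then bind_pmf (bernoulli_pmf (1 / 2)) (\<lambda>first.
       if first then map_pmf (\<lambda>z. (z, y)) (pmf_of_set (neighbours E x))
       else map_pmf (\<lambda>z. (x, z)) (pmf_of_set (neighbours E y)))
     else return_pmf (x, y))"

lemma map_pmf_if: "map_pmf f (if b then M else N) = (if b then map_pmf f M else map_pmf f N)"
  by simp

text \<open>Being selected with probability 2 p and then again with probability 1/2 amounts to
  moving with probability p. This identifies both marginals of the coupling as lazy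
  measures.\<close>

lemma bind_half_jump:
  assumes "0 \<le> p" "p \<le> 1 / 2"
  shows "bind_pmf (bernoulli_pmf (2 * p)) (\<lambda>move.
     if move then bind_pmf (bernoulli_pmf (1 / 2)) (\<lambda>c. if c then M else return_pmf x)
     else return_pmf x) = bind_pmf (bernoulli_pmf (1 - p)) (\<lambda>stay. if stay then return_pmf x else M)"
  by (rule pmf_eqI) (use assms in \<open>simp add: pmf_bind field_simps\<close>)

lemma jump_coupling_marginals:
  assumes "0 \<le> p" "p \<le> 1 / 2"
  shows "map_pmf fst (jump_coupling E p x y) = lazy_measure E (1 - p) x"
    and "map_pmf snd (jump_coupling E p x y) = lazy_measure E (1 - p) y"
proof -
  have swap: "bind_pmf (bernoulli_pmf (1 / 2)) (\<lambda>c. if c then return_pmf y else M)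
      = bind_pmf (bernoulli_pmf (1 / 2)) (\<lambda>c. if c then M else return_pmf y)" for M :: "'a pmf"
    by (rule pmf_eqI) (simp add: pmf_bind)
  show "map_pmf fst (jump_coupling E p x y) = lazy_measure E (1 - p) x"
    by (simp add: jump_coupling_def lazy_measure_def map_bind_pmf map_pmf_if map_pmf_comp
        map_pmf_const map_pmf_ident bind_half_jump[OF assms, symmetric] cong: if_cong)
  show "map_pmf snd (jump_coupling E p x y) = lazy_measure E (1 - p) y"
    by (simp add: jump_coupling_def lazy_measure_def map_bind_pmf map_pmf_if map_pmf_comp
        map_pmf_const map_pmf_ident swap bind_half_jump[OF assms, symmetric] cong: if_cong)
qed

lemma set_jump_coupling:
  assumes "simple_graph V E" "neighbours E x \<noteq> {}" "neighbours E y \<noteq> {}"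
  shows "set_pmf (jump_coupling E p x y) \<subseteq>
    insert (x, y) ((\<lambda>z. (z, y)) ` neighbours E x \<union> (\<lambda>z. (x, z)) ` neighbours E y)"
  using set_pmf_of_set[OF assms(2) finite_neighbours[OF assms(1)]]
    set_pmf_of_set[OF assms(3) finite_neighbours[OF assms(1)]]
  by (auto simp: jump_coupling_def split: if_splits)

text \<open>Kantorovich duality: the potential \<open>f\<close> bounds the cost of every coupling from below, and
  \<open>jump_coupling\<close> attains the bound.\<close>

lemma has_lly_curvature_potential:
  assumes G: "simple_graph V E" and conn: "connected_graph V E" and xy: "{x, y} \<in> E"
    and pos: "\<And>e. e \<in> E \<Longrightarrow> 0 < w e"
    and lip: "\<And>a b. {a, b} \<in> E \<Longrightarrow> f b - f a \<le> w {a, b}"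
    and fxy: "f y - f x = w {x, y}"
    and fx: "\<And>z. {x, z} \<in> E \<Longrightarrow> z \<noteq> y \<Longrightarrow> f x - f z = w {x, z}"
    and fy: "\<And>z. {y, z} \<in> E \<Longrightarrow> z \<noteq> x \<Longrightarrow> f z - f y = w {y, z}"
  shows "has_lly_curvature V E w x y (- mat_app E (ricci_matrix E) w {x, y} / w {x, y})"
proof -
  define d where "d = weighted_dist V E w"
  define c where "c = mat_app E (ricci_matrix E) w {x, y}"
  have finV: "finite V" and xV: "x \<in> V" and yV: "y \<in> V" and neq: "x \<noteq> y" and w0: "0 < w {x, y}"
    using simple_graphD[OF G] xy pos by auto
  have yx: "{y, x} \<in> E" using xy by (simp add: insert_commute)
  have ynx: "y \<in> neighbours E x" and xny: "x \<in> neighbours E y"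
    using xy yx by (auto simp: neighbours_def)
  then have nex: "neighbours E x \<noteq> {}" and ney: "neighbours E y \<noteq> {}" by auto
  have nV: "neighbours E z \<subseteq> V" for z using simple_graphD(4)[OF G] by (auto simp: neighbours_def)
  have d_ge: "f b - f a \<le> d a b" if "a \<in> V" "b \<in> V" for a b
    unfolding d_def using conn that lip
    by (intro weighted_dist_ge[OF finV]) (auto simp: connected_graph_def)
  have d_le: "d a b \<le> path_weight w p" if "p \<in> paths V E a b" for a b p
    unfolding d_def by (rule weighted_dist_le[OF finV that])
  have d_xy: "d x y = w {x, y}"
  proof (rule antisym)
    have "[x, y] \<in> paths V E x y" using xV yV neq xy by (simp add: paths_def)
    from d_le[OF this] show "d x y \<le> w {x, y}" by (simp add: path_weight_def)
    show "w {x, y} \<le> d x y" using d_ge[OF xV yV] fxy by simp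
  qed
  have d_xny: "d z y = f y - f z" if z: "{x, z} \<in> E" for z
  proof (rule antisym)
    have zV: "z \<in> V" and zx: "z \<noteq> x" using simple_graphD(4,5)[OF G z] by auto
    show "f y - f z \<le> d z y" by (rule d_ge[OF zV yV])
    show "d z y \<le> f y - f z"
    proof (cases "z = y")
      case True
      have "[y] \<in> paths V E y y" using yV by (simp add: paths_def)
      from d_le[OF this] show ?thesis by (simp add: True path_weight_def)
    next
      case False
      have "[z, x, y] \<in> paths V E z y" using zV xV yV neq z zx False xy
        by (simp add: paths_def insert_commute)
      from d_le[OF this] show ?thesis using fx[OF z False] fxy
        by (simp add: path_weight_def insert_commute)
    qed
  qed
  have d_xyn: "d x z = f z - f x" if z: "{y, z} \<in> E" for z
  proof (rule antisym)
    have zV: "z \<in> V" and zy: "z \<noteq> y" using simple_graphD(4,5)[OF G z] by auto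
    show "f z - f x \<le> d x z" by (rule d_ge[OF xV zV])
    show "d x z \<le> f z - f x"
    proof (cases "z = x")
      case True
      have "[x] \<in> paths V E x x" using xV by (simp add: paths_def)
      from d_le[OF this] show ?thesis by (simp add: True path_weight_def)
    next
      case False
      have "[x, y, z] \<in> paths V E x z" using zV xV yV neq z zy False xy
        by (simp add: paths_def)
      from d_le[OF this] show ?thesis using fy[OF z False] fxy
        by (simp add: path_weight_def)
    qed
  qed
  \<comment> \<open>A neighbour \<open>z\<close> of \<open>y\<close> lies w {y, z} above
    \<open>y\<close>, except that \<open>x\<close> lies w {x, y} below it; the term 2 w {x, y}
    corrects for this exception. The sum at \<open>x\<close> is its mirror image.\<close>
  have sum_y: "(\<Sum>z\<in>neighbours E y. f z)
      = degree E y * f y + ((\<Sum>z\<in>neighbours E y. w {y, z}) - 2 * w {x, y})"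
  proof -
    have "(\<Sum>z\<in>neighbours E y. f z)
        = (\<Sum>z\<in>neighbours E y. f y + w {y, z} - (if z = x then 2 * w {x, y} else 0))"
    proof (rule sum.cong[OF refl])
      fix z assume "z \<in> neighbours E y"
      then have z: "{y, z} \<in> E" by (simp add: neighbours_def)
      show "f z = f y + w {y, z} - (if z = x then 2 * w {x, y} else 0)"
      proof (cases "z = x")
        case True
        then show ?thesis using fxy by (simp add: insert_commute)
      next
        case False
        then show ?thesis using fy[OF z False] by simp
      qed
    qed
    then show ?thesis using finite_neighbours[OF G] xny
      by (simp add: sum_subtractf sum.distrib degree_def)
  qed
  have sum_x: "(\<Sum>z\<in>neighbours E x. f z)
      = degree E x * f x - ((\<Sum>z\<in>neighbours E x. w {x, z}) - 2 * w {x, y})"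
  proof -
    have "(\<Sum>z\<in>neighbours E x. f z)
        = (\<Sum>z\<in>neighbours E x. f x - w {x, z} + (if z = y then 2 * w {x, y} else 0))"
    proof (rule sum.cong[OF refl])
      fix z assume "z \<in> neighbours E x"
      then have z: "{x, z} \<in> E" by (simp add: neighbours_def)
      show "f z = f x - w {x, z} + (if z = y then 2 * w {x, y} else 0)"
        using fxy fx[OF z] by (cases "z = y") auto
    qed
    then show ?thesis using finite_neighbours[OF G] ynx
      by (simp add: sum_subtractf sum.distrib degree_def)
  qed
  have deg: "0 < degree E x" "0 < degree E y"
    using degree_pos[OF G xy] by auto
  define A where "A z = ((\<Sum>z'\<in>neighbours E z. w {z, z'}) - 2 * w {x, y}) / degree E z" for z
  have c_eq: "c = A x + A y"
    using neq by (simp add: c_def A_def ricci_app[OF G xy] sum_incident[OF G])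
  \<comment> \<open>The coupling moves with total probability 2 (1 - a), which is at most 1 in this
    range; the limit sees only \<open>a\<close> near 1.\<close>
  have W: "wasserstein d (lazy_measure E a x) (lazy_measure E a y) = w {x, y} + (1 - a) * c"
    if a: "1 / 2 < a" "a < 1" for a
  proof -
    have a01: "0 \<le> a" "a \<le> 1" using a by auto
    have val: "measure_pmf.expectation (lazy_measure E a y) f - measure_pmf.expectation (lazy_measure E a x) f
        = w {x, y} + (1 - a) * c"
    proof -
      have q: "(real k * u + v) / real k = u + v / real k" "(real k * u - v) / real k = u - v / real k"
        if "0 < k" for k u v
        using that by (simp_all add: add_divide_distrib diff_divide_distrib)
      have ey: "(\<Sum>z\<in>neighbours E y. f z) / degree E y = f y + A y"
        unfolding sum_y A_def by (rule q(1)[OF deg(2)])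
      have ex: "(\<Sum>z\<in>neighbours E x. f z) / degree E x = f x - A x"
        unfolding sum_x A_def by (rule q(2)[OF deg(1)])
      have "measure_pmf.expectation (lazy_measure E a y) f - measure_pmf.expectation (lazy_measure E a x) f
          = a * (f y - f x) + (1 - a) * (f y - f x + c)"
        unfolding expectation_lazy_measure[OF G nex a01] expectation_lazy_measure[OF G ney a01]
          ex ey c_eq
        by (simp add: algebra_simps)
      then show ?thesis using fxy by (simp add: algebra_simps)
    qed
    have exp_diff: "measure_pmf.expectation P (\<lambda>(u, v). f v - f u) = w {x, y} + (1 - a) * c"
      and fin_P: "finite (set_pmf P)" and sub_P: "set_pmf P \<subseteq> V \<times> V"
      if P: "map_pmf fst P = lazy_measure E a x" "map_pmf snd P = lazy_measure E a y" for P
    proof -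
      have "fst ` set_pmf P \<subseteq> insert x (neighbours E x)"
        using set_pmf_lazy_measure[OF G nex, of a] by (simp flip: P(1))
      moreover have "snd ` set_pmf P \<subseteq> insert y (neighbours E y)"
        using set_pmf_lazy_measure[OF G ney, of a] by (simp flip: P(2))
      ultimately have "set_pmf P \<subseteq> insert x (neighbours E x) \<times> insert y (neighbours E y)"
        by (auto simp: image_subset_iff)
      then show "set_pmf P \<subseteq> V \<times> V" using xV yV nV by blast
      then show fin: "finite (set_pmf P)" using finV by (meson finite_SigmaI finite_subset)
      have "measure_pmf.expectation P (\<lambda>(u, v). f v - f u)
          = measure_pmf.expectation P (\<lambda>z. f (snd z)) - measure_pmf.expectation P (\<lambda>z. f (fst z))"
        unfolding case_prod_beta
        by (rule Bochner_Integration.integral_diff) (rule integrable_measure_pmf_finite[OF fin])+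
      also have "\<dots> = measure_pmf.expectation (map_pmf snd P) f - measure_pmf.expectation (map_pmf fst P) f"
        by simp
      finally show "measure_pmf.expectation P (\<lambda>(u, v). f v - f u) = w {x, y} + (1 - a) * c"
        by (simp add: P val)
    qed
    define P where "P = jump_coupling E (1 - a) x y"
    have P: "map_pmf fst P = lazy_measure E a x" "map_pmf snd P = lazy_measure E a y"
      using jump_coupling_marginals[of "1 - a" E x y] a by (auto simp: P_def)
    \<comment> \<open>Every pair in the support of the coupling is joined by a path of at most three
      vertices on which \<open>f\<close> rises at full slope, so cost and potential difference agree
      there.\<close>
    have "measure_pmf.expectation P (\<lambda>(u, v). d u v) = measure_pmf.expectation P (\<lambda>(u, v). f v - f u)"
    proof (intro integral_cong_AE)
      show "AE z in P. (case z of (u, v) \<Rightarrow> d u v) = (case z of (u, v) \<Rightarrow> f v - f u)"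
        using set_jump_coupling[OF G nex ney, of "1 - a"] d_xny d_xyn d_xy fxy
        by (auto simp: AE_measure_pmf_iff P_def neighbours_def)
    qed auto
    then have attained: "measure_pmf.expectation P (\<lambda>(u, v). d u v) = w {x, y} + (1 - a) * c"
      using exp_diff[OF P] by simp
    have lower: "w {x, y} + (1 - a) * c \<le> measure_pmf.expectation Q (\<lambda>(u, v). d u v)"
      if Q: "map_pmf fst Q = lazy_measure E a x" "map_pmf snd Q = lazy_measure E a y" for Q
    proof -
      have "measure_pmf.expectation Q (\<lambda>(u, v). f v - f u) \<le> measure_pmf.expectation Q (\<lambda>(u, v). d u v)"
        using sub_P[OF Q] d_ge
        by (intro integral_mono_AE integrable_measure_pmf_finite fin_P[OF Q])
          (auto simp: AE_measure_pmf_iff)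
      then show ?thesis using exp_diff[OF Q] by simp
    qed
    show ?thesis unfolding wasserstein_def
    proof (rule cInf_eq_minimum)
      show "w {x, y} + (1 - a) * c \<in> {measure_pmf.expectation P (\<lambda>(x, y). d x y) |P.
          map_pmf fst P = lazy_measure E a x \<and> map_pmf snd P = lazy_measure E a y}"
        using attained P by (intro CollectI exI[of _ P]) simp
    qed (use lower in auto)
  qed
  have "lly_kappa V E w a x y / (1 - a) = - c / w {x, y}" if "1 / 2 < a" "a < 1" for a
    using W[OF that] d_xy w0 that by (simp add: lly_kappa_def flip: d_def) (simp add: field_simps)
  moreover have "\<forall>\<^sub>F a in at_left 1. (1::real) / 2 < a \<and> a < 1"
    by (rule eventually_at_leftI[of "1 / 2"]) auto
  ultimately have "\<forall>\<^sub>F a in at_left 1. lly_kappa V E w a x y / (1 - a) = - c / w {x, y}"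
    by (auto elim: eventually_mono)
  then show ?thesis unfolding has_lly_curvature_def c_def by (rule tendsto_eventually)
qed

section \<open>A cycle attached to a rooted graph\<close>

locale attached =
  fixes V :: "'a set" and E :: "'a set set" and r :: 'a and g :: nat
  assumes G: "simple_graph V E" and conn: "connected_graph V E" and rV: "r \<in> V"
    and E_ne: "E \<noteq> {}" and g3: "3 \<le> g"
begin

abbreviation vx :: "nat \<Rightarrow> 'a + nat" where "vx \<equiv> cycle_vertex r g"
abbreviation ce :: "nat \<Rightarrow> ('a + nat) set" where "ce \<equiv> cycle_edge r g"
abbreviation GE :: "('a + nat) set set" where "GE \<equiv> attached_edges E r g"
abbreviation GV :: "('a + nat) set" where "GV \<equiv> attached_verts V g"

lemma vx_simps: "vx 0 = Inl r" "vx g = Inl r" "0 < i \<Longrightarrow> i < g \<Longrightarrow> vx i = Inr i"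
  by (simp_all add: cycle_vertex_def)

lemma vx_eq_iff: "i < g \<Longrightarrow> j < g \<Longrightarrow> vx i = vx j \<longleftrightarrow> i = j"
  by (auto simp: cycle_vertex_def split: if_splits)

lemma vx_mod: "vx (i mod g) = vx i"
  by (simp add: cycle_vertex_def)

lemma ce_mod: "ce (i mod g) = ce i"
proof -
  have "vx (i mod g + 1) = vx (i + 1)"
    using vx_mod[of "i mod g + 1"] vx_mod[of "i + 1"] by (simp add: mod_Suc_eq)
  then show ?thesis by (simp add: cycle_edge_def vx_mod)
qed

lemma ce_g: "ce g = ce 0" "ce (Suc g) = ce 1"
proof -
  have "Suc g mod g = 1" using g3 by (simp add: mod_Suc)
  then show "ce g = ce 0" "ce (Suc g) = ce 1" using ce_mod[of g] ce_mod[of "Suc g"] by simp_all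
qed

lemma ce_eq: "i < g \<Longrightarrow> ce i = {if i = 0 then Inl r else Inr i, if Suc i = g then Inl r else Inr (Suc i)}"
  by (simp add: cycle_edge_def cycle_vertex_def)

lemma ce_eq_iff: "i < g \<Longrightarrow> j < g \<Longrightarrow> ce i = ce j \<longleftrightarrow> i = j"
  using g3 by (auto simp: ce_eq doubleton_eq_iff split: if_splits)

text \<open>Passes to the indices 0, ..., g - 1, for which the two edges at the root are the ends of
  the range and the recurrence holds strictly inside it.\<close>

lemma ce_image: "ce ` {1..g} = ce ` {..<g}"
proof
  show "ce ` {1..g} \<subseteq> ce ` {..<g}"
  proof
    fix e assume "e \<in> ce ` {1..g}"
    then obtain j where "e = ce (j mod g)" by (auto simp: ce_mod)
    moreover have "j mod g < g" using g3 by simp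
    ultimately show "e \<in> ce ` {..<g}" by blast
  qed
  show "ce ` {..<g} \<subseteq> ce ` {1..g}"
  proof
    fix e assume "e \<in> ce ` {..<g}"
    then obtain j where j: "e = ce j" "j < g" by blast
    show "e \<in> ce ` {1..g}"
    proof (cases "j = 0")
      case True
      then show ?thesis using j g3 ce_g by (intro image_eqI[of _ _ g]) auto
    next
      case False
      then show ?thesis using j by (intro image_eqI[of _ _ j]) auto
    qed
  qed
qed

lemma GE_eq: "GE = (\<lambda>e. Inl ` e) ` E \<union> ce ` {..<g}"
  by (simp only: attached_edges_def ce_image)

lemma GE_cases:
  assumes "d \<in> GE"
  obtains e where "e \<in> E" "d = Inl ` e" | i where "i < g" "d = ce i"
  using assms unfolding GE_eq by blast

lemma ce_in_GE: "ce i \<in> GE"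
proof -
  have "ce (i mod g) \<in> GE" using g3 unfolding GE_eq by auto
  then show ?thesis by (simp only: ce_mod)
qed

lemma Inl_in_GE: "e \<in> E \<Longrightarrow> Inl ` e \<in> GE"
  by (simp add: GE_eq)

lemma ce_neq_Inl: "i < g \<Longrightarrow> ce i \<noteq> Inl ` e"
  using g3 by (auto simp: ce_eq split: if_splits)

lemma Inr_in_ce: "0 < j \<Longrightarrow> j < g \<Longrightarrow> i < g \<Longrightarrow> Inr j \<in> ce i \<longleftrightarrow> i = j - 1 \<or> i = j"
  by (auto simp: ce_eq)

lemma Inl_in_ce: "i < g \<Longrightarrow> Inl x \<in> ce i \<longleftrightarrow> x = r \<and> (i = 0 \<or> i = g - 1)"
  by (auto simp: ce_eq)

lemma vx_in_GV: "vx i \<in> GV"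
  using rV g3 by (auto simp: cycle_vertex_def attached_verts_def)

lemma simple: "simple_graph GV GE"
  unfolding simple_graph_def
proof
  show "finite GV" using simple_graphD(1)[OF G] by (simp add: attached_verts_def)
  show "\<forall>d\<in>GE. \<exists>x\<in>GV. \<exists>y\<in>GV. x \<noteq> y \<and> d = {x, y}"
  proof
    fix d assume "d \<in> GE"
    then show "\<exists>x\<in>GV. \<exists>y\<in>GV. x \<noteq> y \<and> d = {x, y}"
    proof (cases rule: GE_cases)
      case (1 e)
      then obtain x y where "x \<in> V" "y \<in> V" "x \<noteq> y" "e = {x, y}"
        using G by (auto simp: simple_graph_def)
      then show ?thesis using 1 by (intro bexI[of _ "Inl x"] bexI[of _ "Inl y"]) (auto simp: attached_verts_def)
    next
      case (2 i)
      have "vx i \<noteq> vx (i + 1)" using 2 g3 by (auto simp: cycle_vertex_def mod_Suc)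
      then show ?thesis using 2 vx_in_GV by (auto simp: cycle_edge_def)
    qed
  qed
qed

lemma connected: "connected_graph GV GE"
proof -
  have tree: "(Inl r, Inl x) \<in> (adj GE)\<^sup>*" if "(r, x) \<in> (adj E)\<^sup>*" for x
    using that
  proof (induction rule: rtrancl_induct)
    case (step y z)
    have "{Inl y, Inl z} \<in> GE" using step.hyps Inl_in_GE[of "{y, z}"] by (simp add: adj_def)
    then have "(Inl y, Inl z) \<in> adj GE" by (simp add: adj_def)
    then show ?case using step.IH by simp
  qed simp
  have cyc: "(Inl r, vx i) \<in> (adj GE)\<^sup>*" for i
  proof (induction i)
    case 0
    then show ?case by (simp add: vx_simps)
  next
    case (Suc i)
    have "(vx i, vx (Suc i)) \<in> adj GE" using ce_in_GE[of i] by (simp add: adj_def cycle_edge_def)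
    then show ?case using Suc by simp
  qed
  have from_root: "(Inl r, x) \<in> (adj GE)\<^sup>*" if "x \<in> GV" for x
  proof (cases x)
    case (Inl a)
    then have "a \<in> V" using that by (auto simp: attached_verts_def)
    then show ?thesis using tree conn rV Inl by (auto simp: connected_graph_iff[OF G])
  next
    case (Inr i)
    then have "0 < i" "i < g" using that by (auto simp: attached_verts_def)
    then show ?thesis using cyc[of i] Inr by (simp add: vx_simps)
  qed
  have "(a, b) \<in> (adj GE)\<^sup>*" if "a \<in> GV" "b \<in> GV" for a b
    using adj_sym[OF from_root[OF that(1)]] from_root[OF that(2)] by (rule rtrancl_trans)
  moreover have "GV \<noteq> {}" using vx_in_GV by blast
  ultimately show ?thesis unfolding connected_graph_iff[OF simple] by blast
qed

sublocale perron_matrix GE "ricci_matrix GE"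
  by (rule perron_matrix_ricci[OF simple connected]) (use ce_in_GE in blast)

lemma lambda_max_GE: "lambda_max GE = top_eigenvalue"
  by (rule lambda_max_eq_top) unfold_locales

section \<open>The Ricci matrix on tree edges and on cycle edges\<close>

lemma incident_Inr:
  assumes "0 < j" "j < g"
  shows "{d \<in> GE. Inr j \<in> d} = {ce (j - 1), ce j}"
proof -
  have "{d \<in> GE. Inr j \<in> d} = ce ` {i \<in> {..<g}. Inr j \<in> ce i}"
    unfolding GE_eq by auto
  also have "{i \<in> {..<g}. Inr j \<in> ce i} = {j - 1, j}"
    using assms by (auto simp: Inr_in_ce)
  finally show ?thesis by simp
qed

lemma incident_Inl:
  "{d \<in> GE. Inl x \<in> d} = (\<lambda>e. Inl ` e) ` {e \<in> E. x \<in> e} \<union> (if x = r then {ce 0, ce (g - 1)} else {})"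
proof -
  have "{d \<in> GE. Inl x \<in> d} = (\<lambda>e. Inl ` e) ` {e \<in> E. x \<in> e} \<union> ce ` {i \<in> {..<g}. Inl x \<in> ce i}"
    unfolding GE_eq by auto
  also have "{i \<in> {..<g}. Inl x \<in> ce i} = (if x = r then {0, g - 1} else {})"
    using g3 by (auto simp: Inl_in_ce)
  finally show ?thesis by simp
qed

text \<open>The part of the weight at \<open>Inl x\<close> that lies on tree edges. Neither this sum
  nor \<open>deg\<close>, the degree of \<open>Inl x\<close> in \<open>GE\<close>, refers to
  \<open>g\<close>, so both can be compared across cycles of different length.\<close>

definition tree_sum :: "(('a + nat) set \<Rightarrow> real) \<Rightarrow> 'a \<Rightarrow> real" where
  "tree_sum w x = (\<Sum>e\<in>{e \<in> E. x \<in> e}. w (Inl ` e))"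

definition deg :: "'a \<Rightarrow> real" where
  "deg x = real (degree E x) + (if x = r then 2 else 0)"

lemma sum_incident_Inr:
  assumes "0 < j" "j < g"
  shows "(\<Sum>d\<in>{d \<in> GE. Inr j \<in> d}. w d) = w (ce (j - 1)) + w (ce j)"
  using assms by (simp add: incident_Inr ce_eq_iff)

lemma sum_incident_Inl:
  "(\<Sum>d\<in>{d \<in> GE. Inl x \<in> d}. w d) = tree_sum w x + (if x = r then w (ce 0) + w (ce (g - 1)) else 0)"
proof -
  have inj: "inj_on (\<lambda>e. Inl ` e :: ('a + nat) set) {e \<in> E. x \<in> e}"
    by (auto simp: inj_on_def inj_image_eq_iff)
  have fin: "finite {e \<in> E. x \<in> e}" using simple_graphD(2)[OF G] by simp
  have "(\<Sum>d\<in>{d \<in> GE. Inl x \<in> d}. w d) = (\<Sum>d\<in>(\<lambda>e. Inl ` e) ` {e \<in> E. x \<in> e}. w d)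
      + (\<Sum>d\<in>(if x = r then {ce 0, ce (g - 1)} else {}). w d)"
    unfolding incident_Inl using fin g3 ce_neq_Inl[of 0] ce_neq_Inl[of "g - 1"]
    by (intro sum.union_disjoint) auto
  then show ?thesis
    using g3 by (simp add: sum.reindex[OF inj] tree_sum_def ce_eq_iff)
qed

lemma degree_Inr: "0 < j \<Longrightarrow> j < g \<Longrightarrow> degree GE (Inr j) = 2"
  by (simp add: degree_eq_card_incident[OF simple] incident_Inr ce_eq_iff)

lemma degree_Inl: "real (degree GE (Inl x)) = deg x"
  using sum_incident_Inl[where x = x and w = "\<lambda>_. 1"]
  by (simp add: degree_eq_card_incident[OF simple] degree_eq_card_incident[OF G] tree_sum_def deg_def)

lemma app_tree:
  assumes e: "e \<in> E"
  shows "mat_app GE (ricci_matrix GE) w (Inl ` e) =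
    (\<Sum>x\<in>e. (tree_sum w x + (if x = r then w (ce 0) + w (ce (g - 1)) else 0) - 2 * w (Inl ` e)) / deg x)"
  by (simp add: ricci_app[OF simple Inl_in_GE[OF e]] sum.reindex sum_incident_Inl degree_Inl)

lemma app_cycle:
  assumes "0 < i" "i < g - 1"
  shows "mat_app GE (ricci_matrix GE) w (ce i) = (w (ce (i - 1)) + w (ce (i + 1)) - 2 * w (ce i)) / 2"
proof -
  have i: "i < g" "Suc i < g" using assms by auto
  have "ce i = {Inr i, Inr (Suc i)}" using assms by (auto simp: ce_eq)
  then have "mat_app GE (ricci_matrix GE) w (ce i) =
      (\<Sum>x\<in>{Inr i, Inr (Suc i)}. ((\<Sum>d\<in>{d \<in> GE. x \<in> d}. w d) - 2 * w (ce i)) / degree GE x)"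
    using ricci_app[OF simple ce_in_GE[of i]] by simp
  then show ?thesis using assms i
    by (simp add: sum_incident_Inr degree_Inr add_divide_distrib diff_divide_distrib)
qed

lemma app_first:
  "mat_app GE (ricci_matrix GE) w (ce 0) =
    (tree_sum w r + w (ce (g - 1)) - w (ce 0)) / deg r + (w (ce 1) - w (ce 0)) / 2"
proof -
  have "ce 0 = {Inl r, Inr 1}" using g3 by (auto simp: ce_eq)
  then have "mat_app GE (ricci_matrix GE) w (ce 0) =
      (\<Sum>x\<in>{Inl r, Inr 1}. ((\<Sum>d\<in>{d \<in> GE. x \<in> d}. w d) - 2 * w (ce 0)) / degree GE x)"
    using ricci_app[OF simple ce_in_GE[of 0]] by simp
  then show ?thesis using g3
    by (simp add: sum_incident_Inr sum_incident_Inl degree_Inr degree_Inl)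
qed

lemma app_last:
  "mat_app GE (ricci_matrix GE) w (ce (g - 1)) =
    (tree_sum w r + w (ce 0) - w (ce (g - 1))) / deg r + (w (ce (g - 2)) - w (ce (g - 1))) / 2"
proof -
  have "ce (g - 1) = {Inl r, Inr (g - 1)}" using g3 by (auto simp: ce_eq)
  then have "mat_app GE (ricci_matrix GE) w (ce (g - 1)) =
      (\<Sum>x\<in>{Inl r, Inr (g - 1)}. ((\<Sum>d\<in>{d \<in> GE. x \<in> d}. w d) - 2 * w (ce (g - 1))) / degree GE x)"
    using ricci_app[OF simple ce_in_GE[of "g - 1"]] by simp
  moreover have "g - 1 - 1 = g - 2" by simp
  ultimately show ?thesis using g3
    by (simp add: sum_incident_Inr sum_incident_Inl degree_Inr degree_Inl)
qed

text \<open>Tree edges and cycle edges form disjoint families, each injectively indexed. This is how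
  the supersolution and the Rayleigh test weight are built.\<close>

lemma exists_weight:
  obtains w where "\<And>e. e \<in> E \<Longrightarrow> w (Inl ` e) = (t e :: real)" "\<And>i. i < g \<Longrightarrow> w (ce i) = s i"
proof
  define w where "w d = (if \<exists>i<g. d = ce i then s (THE i. i < g \<and> d = ce i) else t (Inl -` d))" for d
  show "w (Inl ` e) = t e" for e
    using ce_neq_Inl[of _ e] by (auto simp: w_def inj_vimage_image_eq)
  show "w (ce i) = s i" if "i < g" for i
  proof -
    have "(THE j. j < g \<and> ce i = ce j) = i" using that by (intro the_equality) (auto simp: ce_eq_iff)
    then show ?thesis using that by (auto simp: w_def)
  qed
qed

lemma sum_GE: "(\<Sum>d\<in>GE. f d) = (\<Sum>e\<in>E. f (Inl ` e)) + (\<Sum>i<g. f (ce i) :: real)"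
proof -
  have inj: "inj_on (\<lambda>e. Inl ` e :: ('a + nat) set) E"
    by (auto simp: inj_on_def inj_image_eq_iff)
  have injc: "inj_on ce {..<g}" by (auto simp: inj_on_def ce_eq_iff)
  have "(\<Sum>d\<in>GE. f d) = (\<Sum>d\<in>(\<lambda>e. Inl ` e) ` E. f d) + (\<Sum>d\<in>ce ` {..<g}. f d)"
    unfolding GE_eq using simple_graphD(2)[OF G] ce_neq_Inl by (intro sum.union_disjoint) auto
  then show ?thesis by (simp add: sum.reindex[OF inj] sum.reindex[OF injc])
qed

lemma cycle_length_eq: "cycle_length r g w = (\<Sum>i<g. w (ce i))"
proof -
  have "cycle_length r g w = (\<Sum>i\<in>{1..<g}. w (ce i)) + w (ce 0)"
    using g3 by (simp add: cycle_length_def ce_g flip: atLeastLessThanSuc_atLeastAtMost)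
  also have "\<dots> = (\<Sum>i\<in>{0..<g}. w (ce i))"
    using g3 by (simp add: sum.atLeast_Suc_lessThan[of 0])
  finally show ?thesis by (simp add: atLeast0LessThan)
qed

end

section \<open>Weights along the cycle\<close>

text \<open>For b \<ge> 2 the recurrence makes \<open>u\<close> convex wherever it is nonnegative,
  so a positive first increment can never shrink.\<close>

lemma recurrence_grow:
  fixes u :: "nat \<Rightarrow> real"
  assumes b: "2 \<le> b" and rec: "\<And>i. 0 < i \<Longrightarrow> i < n \<Longrightarrow> u (i - 1) + u (i + 1) = b * u i"
    and u: "0 \<le> u 0" "u 0 < u 1" and n: "0 < n"
  shows "0 < u n"
proof -
  have "0 \<le> u i \<and> u i < u (Suc i)" if "i < n" for i
    using that
  proof (induction i)
    case 0
    then show ?case using u by simp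
  next
    case (Suc i)
    then have IH: "0 \<le> u i" "u i < u (Suc i)" by auto
    have "u i + u (Suc (Suc i)) = b * u (Suc i)" using rec[of "Suc i"] Suc.prems by simp
    moreover have "2 * u (Suc i) \<le> b * u (Suc i)" using b IH by (intro mult_right_mono) auto
    ultimately have "u (Suc i) < u (Suc (Suc i))" using IH by linarith
    then show ?case using IH by simp
  qed
  from this[of "n - 1"] show ?thesis using n by auto
qed

text \<open>If the first increment were nonzero, growth of \<open>u\<close> or of its negative would
  contradict the value 0 at \<open>n\<close>. With it the first two values vanish, and the
  recurrence propagates this.\<close>

lemma recurrence_zero:
  fixes u :: "nat \<Rightarrow> real"
  assumes b: "2 \<le> b" and rec: "\<And>i. 0 < i \<Longrightarrow> i < n \<Longrightarrow> u (i - 1) + u (i + 1) = b * u i"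
    and u: "u 0 = 0" "u n = 0" and i: "i \<le> n"
  shows "u i = 0"
proof (cases "n = 0")
  case True
  then show ?thesis using u i by simp
next
  case False
  have "\<not> 0 < u 1" using recurrence_grow[OF b rec] u False by force
  moreover have "\<not> u 1 < 0"
  proof
    assume "u 1 < 0"
    have "- u (i - 1) + - u (i + 1) = b * - u i" if "0 < i" "i < n" for i
      using rec[OF that] by simp
    from recurrence_grow[OF b this, of n] show False using \<open>u 1 < 0\<close> u False by simp
  qed
  ultimately have u1: "u 1 = 0" by simp
  have "u i = 0 \<and> (Suc i \<le> n \<longrightarrow> u (Suc i) = 0)" if "i \<le> n" for i
    using that
  proof (induction i)
    case 0
    then show ?case using u u1 by simp
  next
    case (Suc i)
    then show ?case using rec[of "Suc i"] by auto
  qed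
  then show ?thesis using i by blast
qed

text \<open>For positive q a discrete hyperbolic cosine centred at n / 2, up to a factor independent
  of \<open>i\<close>: the symmetric solution of the recurrence with coefficient q + 1 / q.\<close>

definition catenary :: "real \<Rightarrow> nat \<Rightarrow> nat \<Rightarrow> real" where
  "catenary q n i = q ^ i + q ^ (n - i)"

lemma catenary_pos: "0 < q \<Longrightarrow> 0 < catenary q n i"
  by (simp add: catenary_def add_pos_pos)

lemma catenary_0: "catenary q n 0 = 1 + q ^ n" and catenary_n: "catenary q n n = 1 + q ^ n"
  by (simp_all add: catenary_def)

lemma catenary_1: "catenary q n (Suc 0) = q + q ^ (n - 1)"
  by (simp add: catenary_def)

lemma catenary_symmetric: "i \<le> n \<Longrightarrow> catenary q n (n - i) = catenary q n i"
  by (simp add: catenary_def)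

lemma catenary_rec:
  assumes "0 < i" "i < n" "q \<noteq> 0"
  shows "catenary q n (i - 1) + catenary q n (i + 1) = (q + 1 / q) * catenary q n i"
proof -
  obtain k where k: "i = Suc k" using assms by (cases i) auto
  obtain l where l: "n = i + Suc l" using assms less_imp_Suc_add by auto
  show ?thesis using assms(3) by (simp add: catenary_def k l field_simps)
qed

lemma catenary_le_0:
  assumes "0 \<le> q" "q \<le> 1" "i \<le> n"
  shows "catenary q n i \<le> catenary q n 0"
proof -
  have "0 \<le> (1 - q ^ i) * (1 - q ^ (n - i))" using assms by (simp add: power_le_one)
  moreover have "q ^ i * q ^ (n - i) = q ^ n" using assms by (simp flip: power_add)
  ultimately show ?thesis by (simp add: catenary_def algebra_simps)
qed

text \<open>Strictly inside the range, the catenary is q times a catenary whose span is shorter by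
  two, so the bound by the end value applies to the latter.\<close>

lemma catenary_le_1:
  assumes "0 \<le> q" "q \<le> 1" "0 < i" "i < n"
  shows "catenary q n i \<le> catenary q n 1"
proof -
  obtain k where k: "i = Suc k" using assms by (cases i) auto
  obtain l where l: "n = i + Suc l" using assms less_imp_Suc_add by auto
  have "q * catenary q (k + l) k \<le> q * catenary q (k + l) 0"
    using assms by (intro mult_left_mono catenary_le_0) auto
  then show ?thesis by (simp add: catenary_def k l algebra_simps)
qed

text \<open>With the end value fixed, a longer span lowers the next value. This is the inequality
  behind the supersolution at the root.\<close>

lemma catenary_ratio_antimono:
  assumes q: "0 < q" and n: "0 < n"
  shows "catenary q (Suc n) 1 / (1 + q ^ Suc n) \<le> catenary q n 1 / (1 + q ^ n)"
proof -
  obtain k where k: "n = Suc k" using n by (cases n) auto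
  define x where "x = q ^ k"
  have x: "0 < x" using q by (simp add: x_def)
  \<comment> \<open>This expression is the difference of the two cross products compared
    next.\<close>
  have "0 \<le> x * ((q - 1)\<^sup>2 * (q + 1))"
    using q x by (intro mult_nonneg_nonneg) auto
  then have "(q + q * x) * (1 + q * x) \<le> (q + x) * (1 + q * (q * x))"
    by (simp add: power2_eq_square algebra_simps)
  moreover have "0 < 1 + q * x" "0 < 1 + q * (q * x)" using q x by (simp_all add: add_pos_pos)
  ultimately have "(q + q * x) / (1 + q * (q * x)) \<le> (q + x) / (1 + q * x)"
    by (simp add: frac_le_eq mult.commute divide_le_0_iff)
  then show ?thesis by (simp add: catenary_def k x_def)
qed

lemma sum_lessThan_ends:
  fixes f :: "nat \<Rightarrow> real"
  assumes "0 < n"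
  shows "(\<Sum>i<Suc n. f i) = f 0 + (\<Sum>i\<in>{0<..<n}. f i) + f n"
proof -
  have "{..<n} = insert 0 {0<..<n}" using assms by auto
  then show ?thesis by simp
qed

lemma sum_catenary:
  assumes "q \<noteq> 1"
  shows "(\<Sum>i<Suc n. catenary q n i) = 2 * (1 - q ^ Suc n) / (1 - q)"
proof -
  have "(\<Sum>i<Suc n. q ^ (n - i)) = (\<Sum>i<Suc n. q ^ (Suc n - Suc i))" by simp
  also have "\<dots> = (\<Sum>i<Suc n. q ^ i)" by (rule sum.nat_diff_reindex)
  finally have "(\<Sum>i<Suc n. catenary q n i) = 2 * (\<Sum>i<Suc n. q ^ i)"
    unfolding catenary_def sum.distrib by simp
  then show ?thesis using assms by (simp add: sum_gp_strict del: sum.lessThan_Suc)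
qed

text \<open>The larger root of m^2 - 2 (1 + l) m + 1; the closed form gives continuity in
  \<open>l\<close>, needed when the eigenvalues converge.\<close>

definition char_root :: "real \<Rightarrow> real" where
  "char_root l = 1 + l + sqrt ((1 + l)\<^sup>2 - 1)"

lemma char_root:
  assumes "0 < l"
  shows "1 < char_root l" "char_root l + 1 / char_root l = 2 * (1 + l)"
proof -
  have ge: "0 \<le> (1 + l)\<^sup>2 - 1" using assms by (simp add: power2_eq_square algebra_simps)
  then show gt: "1 < char_root l"
    unfolding char_root_def using assms real_sqrt_ge_zero[OF ge] by linarith
  have "(sqrt ((1 + l)\<^sup>2 - 1))\<^sup>2 = (1 + l)\<^sup>2 - 1" using ge by simp
  then have "(1 + l - sqrt ((1 + l)\<^sup>2 - 1)) * char_root l = 1"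
    by (simp add: char_root_def algebra_simps power2_eq_square)
  then have "1 / char_root l = 1 + l - sqrt ((1 + l)\<^sup>2 - 1)" using gt by (simp add: field_simps)
  then show "char_root l + 1 / char_root l = 2 * (1 + l)" by (simp add: char_root_def)
qed

section \<open>Eigenvectors along the cycle and monotonicity in the cycle length\<close>

context attached
begin

text \<open>Connectivity and the existence of an edge give the root a neighbour in the tree, besides
  its two cycle edges.\<close>

lemma deg_r: "3 \<le> deg r"
proof -
  obtain a b where ab: "{a, b} \<in> E" "a \<noteq> b" using E_ne simple_graphD(6)[OF G] by (metis equals0I)
  then obtain x where x: "x \<in> V" "x \<noteq> r" using simple_graphD(3,4)[OF G] by metis
  then have "(r, x) \<in> (adj E)\<^sup>*" using conn rV by (auto simp: connected_graph_iff[OF G])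
  then obtain z where "(r, z) \<in> adj E" using x(2) by (metis converse_rtranclE)
  then have "{r, z} \<in> E" by (simp add: adj_def)
  then have "0 < degree E r" using degree_pos[OF G, of "{r, z}" r] by simp
  then show ?thesis by (simp add: deg_def)
qed

lemma eigen_app:
  assumes "eigenvector_on GE (ricci_matrix GE) w lam" "d \<in> GE"
  shows "mat_app GE (ricci_matrix GE) w d = lam * w d"
  using assms by (simp add: eigenvector_on_mat_app)

lemma eigen_rec:
  assumes "eigenvector_on GE (ricci_matrix GE) w lam" "0 < i" "i < g - 1"
  shows "w (ce (i - 1)) + w (ce (i + 1)) = 2 * (1 + lam) * w (ce i)"
  using eigen_app[OF assms(1) ce_in_GE[of i]] by (simp add: app_cycle[OF assms(2,3)] algebra_simps)

text \<open>The antisymmetric part of an eigenvector on the cycle would have to grow from one end to the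
  other, so it vanishes.\<close>

lemma eigen_ends_eq:
  assumes ev: "eigenvector_on GE (ricci_matrix GE) w lam" and lam: "0 < lam"
  shows "w (ce 0) = w (ce (g - 1))"
proof -
  define u where "u i = w (ce i) - w (ce (g - 1 - i))" for i
  have rec: "u (i - 1) + u (i + 1) = 2 * (1 + lam) * u i" if i: "0 < i" "i < g - 1" for i
  proof -
    have "g - 1 - (i - 1) = g - 1 - i + 1" "g - 1 - (i + 1) = g - 1 - i - 1" using i by auto
    then show ?thesis
      using eigen_rec[OF ev i] eigen_rec[OF ev, of "g - 1 - i"] i
      by (simp add: u_def algebra_simps)
  qed
  have D: "0 < deg r" using deg_r by simp
  have "g - 1 - 1 = g - 2" by simp
  \<comment> \<open>Subtracting the equations of the two root edges cancels the tree. The first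
    increment of \<open>u\<close> then has the sign of \<open>u 0\<close>, so \<open>u\<close> would
    keep this sign up to the last index, where its value is \<open>- u 0\<close>.\<close>
  then have "lam * u 0 = - 2 * u 0 / deg r + (u 1 - u 0) / 2"
    using eigen_app[OF ev ce_in_GE[of 0]] eigen_app[OF ev ce_in_GE[of "g - 1"]]
    unfolding app_first app_last u_def
    by (simp add: algebra_simps add_divide_distrib diff_divide_distrib)
  then have u1: "u 1 = u 0 + (2 * lam + 4 / deg r) * u 0" by (simp add: algebra_simps)
  have pos: "0 < 2 * lam + 4 / deg r" using lam D by (simp add: add_pos_pos)
  have un: "u (g - 1) = - u 0" by (simp add: u_def)
  have b: "2 \<le> 2 * (1 + lam)" and n: "0 < g - 1" using lam g3 by auto
  have "\<not> 0 < u 0"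
  proof
    assume "0 < u 0"
    then have "u 0 < u 1" using mult_pos_pos[OF pos \<open>0 < u 0\<close>] u1 by linarith
    from recurrence_grow[OF b rec _ this n] show False using \<open>0 < u 0\<close> un by simp
  qed
  moreover have "\<not> u 0 < 0"
  proof
    assume "u 0 < 0"
    then have "- u 0 < - u 1" using mult_pos_neg[OF pos \<open>u 0 < 0\<close>] u1 by linarith
    moreover have "- u (i - 1) + - u (i + 1) = 2 * (1 + lam) * - u i" if "0 < i" "i < g - 1" for i
      using rec[OF that] by simp
    ultimately have "0 < - u (g - 1)"
      using recurrence_grow[OF b, of "g - 1" "\<lambda>i. - u i"] \<open>u 0 < 0\<close> n by simp
    then show False using \<open>u 0 < 0\<close> un by simp
  qed
  ultimately have "u 0 = 0" by simp
  then show ?thesis by (simp add: u_def)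
qed

text \<open>The eigenvector and the scaled catenary obey the same recurrence and agree at both ends,
  so their difference vanishes.\<close>

lemma eigen_catenary:
  assumes ev: "eigenvector_on GE (ricci_matrix GE) w lam" and lam: "0 < lam"
    and q: "0 < q" "q + 1 / q = 2 * (1 + lam)" and i: "i < g"
  shows "w (ce i) = w (ce 0) / (1 + q ^ (g - 1)) * catenary q (g - 1) i"
proof -
  define a where "a = w (ce 0) / (1 + q ^ (g - 1))"
  define u where "u i = w (ce i) - a * catenary q (g - 1) i" for i
  have a: "a * (1 + q ^ (g - 1)) = w (ce 0)"
  proof -
    have "0 < 1 + q ^ (g - 1)" using q by (simp add: add_pos_pos)
    then show ?thesis by (simp add: a_def)
  qed
  have "u i = 0"
  proof (rule recurrence_zero)
    show "2 \<le> 2 * (1 + lam)" using lam by simp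
    show "u 0 = 0" unfolding u_def catenary_0 a by simp
    show "u (g - 1) = 0" using eigen_ends_eq[OF ev lam] unfolding u_def catenary_n a by simp
    show "i \<le> g - 1" using i by simp
    show "u (i - 1) + u (i + 1) = 2 * (1 + lam) * u i" if i: "0 < i" "i < g - 1" for i
    proof -
      have "a * catenary q (g - 1) (i - 1) + a * catenary q (g - 1) (i + 1)
          = a * (2 * (1 + lam) * catenary q (g - 1) i)"
        using catenary_rec[OF i, of q] q by (simp add: distrib_left[symmetric])
      then show ?thesis using eigen_rec[OF ev i] by (simp add: u_def algebra_simps)
    qed
  qed
  then show ?thesis by (simp add: u_def a_def)
qed

text \<open>Perron eigenvectors of the cycle of length \<open>g\<close> are stretched to supersolutions on the
  cycle of length \<open>g + 1\<close>.\<close>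

lemma top_eigenvalue_Suc_le:
  assumes lam: "0 < lambda_max GE"
  shows "lambda_max (attached_edges E r (Suc g)) \<le> lambda_max GE"
proof -
  interpret S: attached V E r "Suc g"
    by unfold_locales (use G conn rV E_ne g3 in auto)
  define lam where "lam = top_eigenvalue"
  have lam0: "0 < lam" using lam by (simp add: lam_def lambda_max_GE)
  obtain w where w: "\<And>d. d \<in> GE \<Longrightarrow> 0 < w d" and ev: "eigenvector_on GE (ricci_matrix GE) w lam"
    using top_exists unfolding lam_def by blast
  define q where "q = 1 / char_root lam"
  have q0: "0 < q" and q2: "q + 1 / q = 2 * (1 + lam)"
    using char_root[OF lam0] by (simp_all add: q_def)
  define s0 where "s0 = w (ce 0)"
  have s0: "0 < s0" using w[OF ce_in_GE] by (simp add: s0_def)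
  have last: "w (ce (g - 1)) = s0" using eigen_ends_eq[OF ev lam0] by (simp add: s0_def)
  \<comment> \<open>Scaled so that both root edges keep the weight \<open>s0\<close>; the equations
    on the tree edges are then literally unchanged.\<close>
  define a' where "a' = s0 / (1 + q ^ g)"
  have a': "0 < a'" "a' * (1 + q ^ g) = s0"
  proof -
    have "0 < 1 + q ^ g" using q0 by (simp add: add_pos_pos)
    then show "0 < a'" "a' * (1 + q ^ g) = s0" using s0 by (simp_all add: a'_def)
  qed
  obtain w' where w'1: "\<And>e. e \<in> E \<Longrightarrow> w' (Inl ` e) = w (Inl ` e)"
    and w'2: "\<And>i. i < Suc g \<Longrightarrow> w' (S.ce i) = a' * catenary q g i"
    by (rule S.exists_weight[of "\<lambda>e. w (Inl ` e)" "\<lambda>i. a' * catenary q g i"]) blast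
  have ends: "w' (S.ce 0) = s0" "w' (S.ce g) = s0"
    using w'2[of 0] w'2[of g] a' by (simp_all add: catenary_0 catenary_n)
  have ts: "tree_sum w' x = tree_sum w x" for x
    by (simp add: tree_sum_def w'1)
  have step: "a' * catenary q g 1 \<le> w (ce 1)"
  proof -
    have "s0 * (catenary q g 1 / (1 + q ^ g)) \<le> s0 * (catenary q (g - 1) 1 / (1 + q ^ (g - 1)))"
      using s0 g3 q0 catenary_ratio_antimono[of q "g - 1"] by (intro mult_left_mono) auto
    moreover have "w (ce 1) = s0 * (catenary q (g - 1) 1 / (1 + q ^ (g - 1)))"
      using eigen_catenary[OF ev lam0 q0 q2, of 1] g3 unfolding s0_def by simp
    moreover have "a' * catenary q g 1 = s0 * (catenary q g 1 / (1 + q ^ g))"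
      unfolding a'_def by simp
    ultimately show ?thesis by simp
  qed
  have "S.top_eigenvalue \<le> lam"
  proof (rule S.top_eigenvalue_le)
    show "0 < w' d" if "d \<in> S.GE" for d
      using that by (cases rule: S.GE_cases)
        (use w Inl_in_GE a' q0 catenary_pos in \<open>auto simp: w'1 w'2\<close>)
    show "mat_app S.GE (ricci_matrix S.GE) w' d \<le> lam * w' d" if "d \<in> S.GE" for d
      using that
    proof (cases rule: S.GE_cases)
      case (1 e)
      let ?t = "\<Sum>x\<in>e. (tree_sum w x + (if x = r then s0 + s0 else 0) - 2 * w (Inl ` e)) / deg x"
      have "mat_app S.GE (ricci_matrix S.GE) w' (Inl ` e) = ?t"
        using S.app_tree[OF 1(1), of w'] unfolding ts w'1[OF 1(1)] diff_Suc_1 ends .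
      moreover have "mat_app GE (ricci_matrix GE) w (Inl ` e) = ?t"
        using app_tree[OF 1(1), of w] unfolding last s0_def[symmetric] .
      ultimately have "mat_app S.GE (ricci_matrix S.GE) w' d = mat_app GE (ricci_matrix GE) w (Inl ` e)"
        by (simp only: 1(2))
      also have "\<dots> = lam * w' d" using eigen_app[OF ev Inl_in_GE[OF 1(1)]] by (simp add: 1 w'1)
      finally show ?thesis by simp
    next
      case (2 i)
      \<comment> \<open>Compared with the eigenvector equation for length \<open>g\<close>, only the
        weight of the next cycle edge differs, and it has become smaller.\<close>
      have first: "(tree_sum w r + s0 - s0) / deg r + (w' (S.ce 1) - s0) / 2 \<le> lam * s0"
      proof -
        have "(tree_sum w r + s0 - s0) / deg r + (w (ce 1) - s0) / 2 = lam * s0"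
          using eigen_app[OF ev ce_in_GE[of 0]] unfolding app_first last s0_def[symmetric] .
        moreover have "w' (S.ce 1) = a' * catenary q g 1" using w'2[of 1] g3 by simp
        moreover have "(w' (S.ce 1) - s0) / 2 \<le> (w (ce 1) - s0) / 2"
          using step calculation(2) by simp
        ultimately show ?thesis by linarith
      qed
      consider "i = 0" | "i = g" | "0 < i" "i < g" using 2 by linarith
      then show ?thesis
      proof cases
        case 1
        then show ?thesis using first ends unfolding 2(2) 1 S.app_first by (simp add: ts)
      next
        case 2
        have "w' (S.ce (g - 1)) = w' (S.ce 1)"
          using w'2[of 1] w'2[of "g - 1"] catenary_symmetric[of 1 g q] g3 by simp
        then show ?thesis
          using first ends S.app_last[of w'] unfolding \<open>d = S.ce i\<close> 2
          by (simp add: ts numeral_2_eq_2)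
      next
        case 3
        have "a' * catenary q g (i - 1) + a' * catenary q g (i + 1) = a' * (2 * (1 + lam) * catenary q g i)"
          using catenary_rec[OF 3, of q] q0 q2 by (simp add: distrib_left[symmetric])
        then show ?thesis using 3 S.app_cycle[of i w'] unfolding 2(2)
          by (simp add: w'2 algebra_simps)
      qed
    qed
  qed
  then show ?thesis by (simp add: lam_def lambda_max_GE S.lambda_max_GE)
qed

section \<open>A lower bound for the largest eigenvalue, uniform in the cycle length\<close>

lemma sum_verts_incident: "(\<Sum>x\<in>V. \<Sum>e\<in>{e \<in> E. x \<in> e}. F x e) = (\<Sum>e\<in>E. \<Sum>x\<in>e. F x e :: real)"
proof -
  have fV: "finite V" and fE: "finite E" using simple_graphD[OF G] by auto
  have "(\<Sum>x\<in>V. \<Sum>e\<in>{e \<in> E. x \<in> e}. F x e) = (\<Sum>e\<in>E. \<Sum>x\<in>{x \<in> V. x \<in> e}. F x e)"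
    by (rule sum.swap_restrict[OF fV fE])
  also have "\<dots> = (\<Sum>e\<in>E. \<Sum>x\<in>e. F x e)"
    using G by (intro sum.cong) (auto simp: simple_graph_def)
  finally show ?thesis .
qed

text \<open>Rayleigh quotient of the weight that is 1 on the tree and decays from the value 2 along the
  cycle; the value 2 makes the tree contribute at least \<open>2 |E| - 2 (|V| - 1) \<ge> 0\<close>.\<close>

lemma lambda_max_lower: "8 / 15 / (card E + 40) \<le> lambda_max GE"
proof -
  \<comment> \<open>The root edges need 1/3 > 1 - q and the norm bound needs q < 1; any choice
    between 2/3 and 1 works. With 4/5 each root edge contributes at least 2 (1/3 - 1/5) = 4/15, and
    the cycle part of the squared norm is at most 8 / (1 - q) = 40.\<close>
  define q :: real where "q = 4 / 5"
  have q0: "0 < q" "q < 1" "q \<noteq> 0" by (simp_all add: q_def)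
  define n where "n = g - 1"
  have gn: "g = Suc n" using g3 by (simp add: n_def)
  define a where "a = 2 / (1 + q ^ n)"
  have den: "1 \<le> 1 + q ^ n" using q0 by simp
  have a: "0 < a" "a \<le> 2" "a * (1 + q ^ n) = 2"
    using den by (simp_all add: a_def field_simps)
  obtain w where wt: "\<And>e. e \<in> E \<Longrightarrow> w (Inl ` e) = (1 :: real)"
    and wc: "\<And>i. i < g \<Longrightarrow> w (ce i) = a * catenary q n i"
    by (rule exists_weight[of "\<lambda>_. 1" "\<lambda>i. a * catenary q n i"]) blast
  define D where "D = real (degree E r)"
  have D: "1 \<le> D" "deg r = D + 2" using deg_r by (simp_all add: D_def deg_def)
  have c0: "w (ce 0) = 2" "w (ce n) = 2"
    using wc[of 0] wc[of n] a gn by (simp_all add: catenary_0 catenary_n)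
  have c1: "8 / 5 \<le> w (ce 1)" "w (ce (g - 2)) = w (ce 1)"
  proof -
    have "q * (1 + q ^ n) \<le> q + q ^ (n - 1)"
      using q0 g3 gn power_decreasing[of "n - 1" "Suc n" q] by (simp add: distrib_left)
    then have "a * (q * (1 + q ^ n)) \<le> a * catenary q n 1"
      using a by (simp add: catenary_1)
    moreover have "a * (q * (1 + q ^ n)) = q * 2" by (metis a(3) mult.left_commute)
    ultimately show "8 / 5 \<le> w (ce 1)" using wc[of 1] g3 by (simp add: q_def)
    have "g - 2 = n - 1" using gn by simp
    then show "w (ce (g - 2)) = w (ce 1)"
      using wc[of 1] wc[of "g - 2"] g3 gn catenary_symmetric[of 1 n q] by simp
  qed
  have ts: "tree_sum w x = degree E x" for x
    by (simp add: tree_sum_def wt degree_eq_card_incident[OF G])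
  let ?R = "mat_app GE (ricci_matrix GE) w"
  have tree: "0 \<le> (\<Sum>e\<in>E. w (Inl ` e) * ?R (Inl ` e))"
  proof -
    define F where "F x = (real (degree E x) + (if x = r then 4 else 0) - 2) / deg x" for x
    have "(\<Sum>e\<in>E. w (Inl ` e) * ?R (Inl ` e)) = (\<Sum>e\<in>E. \<Sum>x\<in>e. F x)" (is "?L = _")
      by (intro sum.cong refl) (auto simp: app_tree ts F_def wt c0 simp flip: n_def simp del: One_nat_def intro!: sum.cong)
    also have "\<dots> = (\<Sum>x\<in>V. degree E x * F x)"
      by (simp add: sum_verts_incident[symmetric] degree_eq_card_incident[OF G])
    finally have L: "?L = (\<Sum>x\<in>V. degree E x * F x)" .
    \<comment> \<open>At the root the numerator of \<open>F\<close> is D + 4 - 2 =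
      \<open>deg r\<close>, so the root contributes its full tree degree; another vertex of positive
      degree contributes its degree minus 2.\<close>
    have "(\<Sum>x\<in>V. real (degree E x) - (if x = r then 0 else 2 :: real)) \<le> ?L"
      unfolding L
    proof (rule sum_mono)
      fix x
      show "real (degree E x) - (if x = r then 0 else 2 :: real) \<le> degree E x * F x"
      proof (cases "x = r")
        case True
        then show ?thesis using D by (simp add: F_def field_simps flip: D_def)
      next
        case False
        then show ?thesis by (cases "degree E x = 0") (simp_all add: F_def deg_def)
      qed
    qed
    moreover have "(\<Sum>x\<in>V. real (degree E x) - (if x = r then 0 else 2 :: real)) = 2 * real (card E) - 2 * (real (card V) - 1)"
    proof -
      have two: "card e = 2" if "e \<in> E" for e
        using simple_graphD(6)[OF G that] by auto
      have "(\<Sum>x\<in>V. real (degree E x)) = (\<Sum>e\<in>E. real (card e))"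
        using sum_verts_incident[of "\<lambda>_ _. 1"] by (simp add: degree_eq_card_incident[OF G])
      also have "\<dots> = 2 * real (card E)" by (simp add: two)
      finally have "(\<Sum>x\<in>V. real (degree E x)) = 2 * real (card E)" .
      moreover have "(\<Sum>x\<in>V. if x = r then 0 else 2 :: real) = 2 * (real (card V) - 1)"
      proof -
        have fV: "finite V" by (rule simple_graphD(1)[OF G])
        have "(\<Sum>x\<in>V. if x = r then 0 else 2 :: real) = (\<Sum>x\<in>V. 2 - (if x = r then 2 else 0))"
          by (intro sum.cong) auto
        then show ?thesis using fV rV by (simp add: sum_subtractf)
      qed
      ultimately show ?thesis by (simp add: sum_subtractf)
    qed
    moreover have "0 \<le> 2 * real (card E) - 2 * (real (card V) - 1)"
    proof -
      have "real (card V) \<le> real (card E + 1)"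
        using card_verts_le_card_edges[OF G conn] by (rule of_nat_mono)
      then show ?thesis by simp
    qed
    ultimately show ?thesis by linarith
  qed
  have cyc: "8 / 15 \<le> (\<Sum>i<g. w (ce i) * ?R (ce i))"
  proof -
    have end_val: "4 / 15 \<le> 2 * (D / (D + 2) + (w (ce 1) - 2) / 2)"
    proof -
      have "1 / 3 \<le> D / (D + 2)" using D(1) by (simp add: field_simps)
      moreover have "4 / 15 \<le> 2 * (x + (y - 2) / 2)" if "1 / 3 \<le> x" "8 / 5 \<le> y" for x y :: real
        using that by (simp add: diff_divide_distrib)
      ultimately show ?thesis using c1(1) by blast
    qed
    have "?R (ce 0) = D / (D + 2) + (w (ce 1) - 2) / 2"
      using app_first[of w] unfolding n_def[symmetric] c0 ts D(2) D_def[symmetric] by simp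
    moreover have "?R (ce n) = D / (D + 2) + (w (ce 1) - 2) / 2"
      using app_last[of w] unfolding n_def[symmetric] c0 c1(2) ts D(2) D_def[symmetric] by simp
    ultimately have f: "4 / 15 \<le> w (ce 0) * ?R (ce 0)" "4 / 15 \<le> w (ce n) * ?R (ce n)"
      unfolding c0 using end_val by simp_all
    have mid: "0 \<le> w (ce i) * ?R (ce i)" if i: "0 < i" "i < n" for i
    proof -
      have ig: "i < g" "i - 1 < g" "i + 1 < g" "i < g - 1" using i gn by auto
      have wi: "0 < w (ce i)" using ig(1) a q0 by (simp add: wc catenary_pos)
      have "w (ce (i - 1)) + w (ce (i + 1)) = (q + 1 / q) * w (ce i)"
        using catenary_rec[OF i q0(3)] unfolding wc[OF ig(1)] wc[OF ig(2)] wc[OF ig(3)]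
        by (simp add: distrib_left[symmetric])
      then have "?R (ce i) = (q + 1 / q - 2) / 2 * w (ce i)"
        using app_cycle[OF i(1) ig(4), of w] by (simp add: algebra_simps)
      then show ?thesis using wi by (simp add: q_def)
    qed
    have n2: "0 < n" using gn g3 by simp
    have "(\<Sum>i<g. w (ce i) * ?R (ce i)) = w (ce 0) * ?R (ce 0) + (\<Sum>i\<in>{0<..<n}. w (ce i) * ?R (ce i)) + w (ce n) * ?R (ce n)"
      using sum_lessThan_ends[OF n2, of "\<lambda>i. w (ce i) * ?R (ce i)"] unfolding gn[symmetric] .
    moreover have "0 \<le> (\<Sum>i\<in>{0<..<n}. w (ce i) * ?R (ce i))"
      by (rule sum_nonneg) (use mid in auto)
    ultimately show ?thesis using f by linarith
  qed
  have form: "8 / 15 \<le> dot_on GE w ?R"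
    unfolding dot_on_def sum_GE using tree cyc by linarith
  have norm: "dot_on GE w w \<le> card E + 40"
  proof -
    \<comment> \<open>One factor is bounded by the end value 2, the other by twice the catenary,
      which leaves geometric sums bounded independently of \<open>g\<close>.\<close>
    have "(\<Sum>i<g. w (ce i) * w (ce i)) \<le> (\<Sum>i<g. 4 * catenary q n i)"
    proof (rule sum_mono)
      fix i assume "i \<in> {..<g}"
      then have i: "i < g" "i \<le> n" using gn by auto
      have pos: "0 < catenary q n i" using q0 by (simp add: catenary_pos)
      have "a * catenary q n i \<le> a * catenary q n 0"
        using a q0 i by (intro mult_left_mono catenary_le_0) auto
      then have "w (ce i) \<le> 2" using a i by (simp add: wc catenary_0)
      moreover have "w (ce i) \<le> 2 * catenary q n i" using a pos i by (simp add: wc)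
      moreover have "0 \<le> w (ce i)" using a pos i by (simp add: wc)
      ultimately have "w (ce i) * w (ce i) \<le> 2 * (2 * catenary q n i)" by (intro mult_mono) auto
      then show "w (ce i) * w (ce i) \<le> 4 * catenary q n i" by simp
    qed
    also have "\<dots> = 4 * (2 * (1 - q ^ Suc n) / (1 - q))"
      unfolding gn using sum_catenary[of q n] q0 by (simp only: sum_distrib_left[symmetric])
    also have "\<dots> \<le> 40" using q0(1) by (simp add: q_def)
    finally show ?thesis unfolding dot_on_def sum_GE by (simp add: wt)
  qed
  have le: "8 / 15 \<le> top_eigenvalue * dot_on GE w w" using rayleigh[of w] form by linarith
  have "0 < top_eigenvalue"
  proof (rule ccontr)
    assume "\<not> 0 < top_eigenvalue"
    then have "top_eigenvalue * dot_on GE w w \<le> 0"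
      by (intro mult_nonpos_nonneg dot_on_self_nonneg) simp
    then show False using le by simp
  qed
  then have "top_eigenvalue * dot_on GE w w \<le> top_eigenvalue * (card E + 40)"
    using norm by (intro mult_left_mono) auto
  then have "8 / 15 \<le> top_eigenvalue * (card E + 40)" using le by linarith
  moreover have "0 < real (card E + 40)" by simp
  ultimately show ?thesis by (simp only: lambda_max_GE pos_divide_le_eq)
qed

lemma lambda_max_pos: "0 < lambda_max GE"
  by (rule less_le_trans[OF _ lambda_max_lower]) (simp add: add_nonneg_pos)

end

subsection \<open>Consecutive edges\<close>

text \<open>Twice the end value plus the adjacent value of the catenary of span g - 1, over the sum
  of its g values.\<close>

definition end_ratio :: "nat \<Rightarrow> real \<Rightarrow> real" where
  "end_ratio g q = (2 * (1 + q ^ (g - 1)) + (q + q ^ (g - 2))) * (1 - q) / (2 * (1 - q ^ g))"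

lemma Suc_mod_cancel: "Suc a mod n = Suc b mod n \<longleftrightarrow> a mod n = b mod n"
  unfolding nat_mod_eq_iff by simp

lemma mod_neq_of_close:
  fixes a b n :: nat
  assumes "a < b" "b < a + n"
  shows "a mod n \<noteq> b mod n"
proof
  assume "a mod n = b mod n"
  then have "n dvd b - a" using mod_eq_dvd_iff_nat[of a b n] assms by simp
  then have "n \<le> b - a" using assms by (intro dvd_imp_le) auto
  then show False using assms by simp
qed

context attached
begin

abbreviation decay :: real where "decay \<equiv> 1 / char_root (lambda_max GE)"

lemma decay: "0 < decay" "decay < 1" "decay + 1 / decay = 2 * (1 + lambda_max GE)"
  using char_root[OF lambda_max_pos] by simp_all

lemma perron_cycle:
  assumes "perron_eigenvector GE w"
  obtains a where "0 < a" "\<And>i. i < g \<Longrightarrow> w (ce i) = a * catenary decay (g - 1) i"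
proof
  have w: "\<And>d. d \<in> GE \<Longrightarrow> 0 < w d"
    and ev: "eigenvector_on GE (ricci_matrix GE) w (lambda_max GE)"
    using assms by (auto simp: perron_eigenvector_def)
  have "0 < 1 + decay ^ (g - 1)" using decay(1) by (intro add_pos_pos zero_less_power) auto
  then show "0 < w (ce 0) / (1 + decay ^ (g - 1))" using w[OF ce_in_GE] by (rule divide_pos_pos[rotated])
  show "w (ce i) = w (ce 0) / (1 + decay ^ (g - 1)) * catenary decay (g - 1) i" if "i < g" for i
    by (rule eigen_catenary[OF ev lambda_max_pos decay(1,3) that])
qed

lemma perron_cycle_order:
  assumes "perron_eigenvector GE w"
  shows "w (ce (g - 1)) = w (ce 0)" "w (ce (g - 2)) = w (ce 1)"
    "i < g \<Longrightarrow> w (ce i) \<le> w (ce 0)" "0 < i \<Longrightarrow> i < g - 1 \<Longrightarrow> w (ce i) \<le> w (ce 1)"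
proof -
  obtain a where a: "0 < a" "\<And>i. i < g \<Longrightarrow> w (ce i) = a * catenary decay (g - 1) i"
    using perron_cycle[OF assms] by blast
  show "w (ce (g - 1)) = w (ce 0)"
    using a(2)[of 0] a(2)[of "g - 1"] g3 catenary_symmetric[of 0 "g - 1" decay] by simp
  have "g - 1 - 1 = g - 2" by simp
  then show "w (ce (g - 2)) = w (ce 1)"
    using a(2)[of 1] a(2)[of "g - 2"] g3 catenary_symmetric[of 1 "g - 1" decay] by simp
  show "w (ce i) \<le> w (ce 0)" if "i < g"
    using a(2)[OF that] a(2)[of 0] a(1) g3 that decay catenary_le_0[of decay i "g - 1"] by simp
  show "w (ce i) \<le> w (ce 1)" if i: "0 < i" "i < g - 1"
    using a(2)[of i] a(2)[of 1] a(1) g3 i decay catenary_le_1[of decay i "g - 1"] by simp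
qed

text \<open>The triple at index \<open>g\<close> straddles the root. If the middle edge of a triple
  does not touch the root, it weighs at most \<open>w (ce 1)\<close>; the other two weigh at most
  \<open>w (ce 0)\<close> each. The triple at g - 1 is the mirror image of the one at
  \<open>g\<close>.\<close>

lemma triple_weight_bound:
  assumes w: "perron_eigenvector GE w"
  shows "j \<in> {1..g} \<Longrightarrow> triple_weight r g w j \<le> 2 * w (ce 0) + w (ce 1)"
    and "triple_weight r g w g = 2 * w (ce 0) + w (ce 1)"
proof -
  note o = perron_cycle_order[OF w]
  show eq: "triple_weight r g w g = 2 * w (ce 0) + w (ce 1)"
    using o(1) ce_g by (simp add: triple_weight_def)
  assume j: "j \<in> {1..g}"
  consider "j = g" | "j = g - 1" | "0 < j" "j < g - 1" using j by fastforce
  then show "triple_weight r g w j \<le> 2 * w (ce 0) + w (ce 1)"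
  proof cases
    case 1
    then show ?thesis using eq by simp
  next
    case 2
    have "g - 1 - 1 = g - 2" "g - 1 + 1 = g" using g3 by auto
    then show ?thesis using o(1,2) unfolding triple_weight_def 2 by (simp add: ce_g)
  next
    case 3
    then have "j - 1 < g" "j + 1 < g" by auto
    then show ?thesis
      using o(3)[of "j - 1"] o(3)[of "j + 1"] o(4)[OF 3] unfolding triple_weight_def by linarith
  qed
qed

lemma cycle_length_pos:
  assumes "perron_eigenvector GE w"
  shows "0 < cycle_length r g w"
proof -
  have "0 < w (ce i)" for i using assms ce_in_GE by (auto simp: perron_eigenvector_def)
  moreover have "0 \<in> {..<g}" using g3 by simp
  ultimately show ?thesis unfolding cycle_length_eq by (intro sum_pos) auto
qed

lemma max_triple_ratio_eq:
  assumes w: "perron_eigenvector GE w"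
  shows "max_triple_ratio r g w = end_ratio g decay"
proof -
  have "max_triple_ratio r g w = (2 * w (ce 0) + w (ce 1)) / cycle_length r g w"
    unfolding max_triple_ratio_def
  proof (rule Max_eqI)
    show "y \<le> (2 * w (ce 0) + w (ce 1)) / cycle_length r g w"
      if "y \<in> (\<lambda>j. triple_weight r g w j / cycle_length r g w) ` {1..g}" for y
      using that triple_weight_bound(1)[OF w] cycle_length_pos[OF w]
      by (auto intro!: divide_right_mono)
    show "(2 * w (ce 0) + w (ce 1)) / cycle_length r g w
        \<in> (\<lambda>j. triple_weight r g w j / cycle_length r g w) ` {1..g}"
      using triple_weight_bound(2)[OF w] g3 by (intro image_eqI[of _ _ g]) auto
  qed simp
  also have "\<dots> = end_ratio g decay"
  proof -
    obtain a where a: "0 < a" "\<And>i. i < g \<Longrightarrow> w (ce i) = a * catenary decay (g - 1) i"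
      using perron_cycle[OF w] by blast
    define q where "q = decay"
    have q: "q < 1" using decay(2) by (simp only: q_def)
    have gS: "Suc (g - 1) = g" using g3 by simp
    have "cycle_length r g w = a * (\<Sum>i<Suc (g - 1). catenary q (g - 1) i)"
      unfolding cycle_length_eq gS sum_distrib_left q_def using a(2) by (intro sum.cong) auto
    also have "\<dots> = a * (2 * (1 - q ^ g) / (1 - q))"
      using sum_catenary[of q "g - 1"] q unfolding gS by simp
    finally have len: "cycle_length r g w = a * (2 * (1 - q ^ g) / (1 - q))" .
    have "g - 1 - 1 = g - 2" by simp
    then have "2 * w (ce 0) + w (ce 1) = a * (2 * (1 + q ^ (g - 1)) + (q + q ^ (g - 2)))"
      using a(2)[of 0] a(2)[of 1] g3 unfolding q_def[symmetric]
      by (simp add: catenary_def algebra_simps)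
    moreover have "a * x / (a * (y / (1 - q))) = x * (1 - q) / y" for x y
      using a(1) by simp
    ultimately show ?thesis unfolding len q_def[symmetric] end_ratio_def by simp
  qed
  finally show ?thesis .
qed

end

subsection \<open>Transport potentials\<close>

text \<open>The arcs on which the potential has to climb at full slope: into \<open>x\<close>, from
  \<open>x\<close> to \<open>y\<close>, and out of \<open>y\<close>. The inequalities keep the arc
  from \<open>y\<close> back to \<open>x\<close> out.\<close>

definition transport_arc :: "'v \<Rightarrow> 'v \<Rightarrow> 'v \<Rightarrow> 'v \<Rightarrow> bool" where
  "transport_arc x y u v \<longleftrightarrow> (v = x \<and> u \<noteq> y) \<or> (u = x \<and> v = y) \<or> (u = y \<and> v \<noteq> x)"

text \<open>Antisymmetrised, so that it prescribes an increment for either orientation of an edge,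
  as \<open>acyclic_potential\<close> demands, and vanishes on edges away from \<open>x\<close> and
  \<open>y\<close>.\<close>

definition transport_slope :: "('v set \<Rightarrow> real) \<Rightarrow> 'v \<Rightarrow> 'v \<Rightarrow> 'v \<Rightarrow> 'v \<Rightarrow> real" where
  "transport_slope w x y u v =
     w {u, v} * (of_bool (transport_arc x y u v) - of_bool (transport_arc x y v u))"

definition transport_potential ::
    "'v set set \<Rightarrow> ('v set \<Rightarrow> real) \<Rightarrow> 'v \<Rightarrow> 'v \<Rightarrow> ('v \<Rightarrow> real) \<Rightarrow> bool" where
  "transport_potential E w x y f \<longleftrightarrow> (\<forall>a b. {a, b} \<in> E \<longrightarrow>
     \<bar>f b - f a\<bar> \<le> w {a, b} \<and> ({a, b} \<inter> {x, y} \<noteq> {} \<longrightarrow> f b - f a = transport_slope w x y a b))"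

lemma transport_slope_anti: "transport_slope w x y v u = - transport_slope w x y u v"
  unfolding transport_slope_def insert_commute[of v u] by (simp add: algebra_simps)

lemma transport_slope_flip: "transport_slope w y x u v = - transport_slope w x y u v"
proof -
  have "transport_arc y x u v = transport_arc x y v u" for u v :: 'a
    by (auto simp: transport_arc_def)
  then show ?thesis unfolding transport_slope_def by (simp add: algebra_simps)
qed

lemma transport_slope_le: "0 \<le> w {u, v} \<Longrightarrow> \<bar>transport_slope w x y u v\<bar> \<le> w {u, v}"
  unfolding transport_slope_def
  by (cases "transport_arc x y u v"; cases "transport_arc x y v u") simp_all

lemma transport_slope_0:
  assumes "{u, v} \<inter> {x, y} = {}"
  shows "transport_slope w x y u v = 0"
proof -
  have "\<not> transport_arc x y u v" "\<not> transport_arc x y v u"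
    using assms unfolding transport_arc_def by blast+
  then show ?thesis by (simp add: transport_slope_def)
qed

text \<open>The Einstein condition covers both orders of the ends of an edge; negating a potential
  for one order serves the other.\<close>

lemma transport_potential_flip:
  assumes "transport_potential E w x y f"
  shows "transport_potential E w y x (\<lambda>v. - f v)"
  unfolding transport_potential_def
proof (intro allI impI conjI)
  fix a b assume ab: "{a, b} \<in> E"
  then have "\<bar>f b - f a\<bar> \<le> w {a, b}"
    using assms unfolding transport_potential_def by blast
  then show "\<bar>- f b - - f a\<bar> \<le> w {a, b}" by linarith
  assume "{a, b} \<inter> {y, x} \<noteq> {}"
  then have "{a, b} \<inter> {x, y} \<noteq> {}" by auto
  then have "f b - f a = transport_slope w x y a b"
    using assms ab unfolding transport_potential_def by blast
  then show "- f b - - f a = transport_slope w y x a b"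
    unfolding transport_slope_flip[of w y x] by linarith
qed

lemma has_lly_curvature_transport:
  assumes G: "simple_graph V E" and conn: "connected_graph V E" and xy: "{x, y} \<in> E"
    and pos: "\<And>e. e \<in> E \<Longrightarrow> 0 < w e" and f: "transport_potential E w x y f"
  shows "has_lly_curvature V E w x y (- mat_app E (ricci_matrix E) w {x, y} / w {x, y})"
proof (rule has_lly_curvature_potential[OF G conn xy pos])
  have slope: "f b - f a = transport_slope w x y a b" if "{a, b} \<in> E" "{a, b} \<inter> {x, y} \<noteq> {}" for a b
    using f that unfolding transport_potential_def by blast
  have neq: "a \<noteq> b" if "{a, b} \<in> E" for a b using simple_graphD(5)[OF G that] .
  show "f b - f a \<le> w {a, b}" if "{a, b} \<in> E" for a b
    using f that by (simp add: transport_potential_def abs_le_iff)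
  show "f y - f x = w {x, y}"
    using slope[OF xy] neq[OF xy] by (simp add: transport_slope_def transport_arc_def)
  show "f x - f z = w {x, z}" if "{x, z} \<in> E" "z \<noteq> y" for z
    using slope[of z x] that neq[of x z] neq[OF xy]
    by (simp add: transport_slope_def transport_arc_def insert_commute)
  show "f z - f y = w {y, z}" if "{y, z} \<in> E" "z \<noteq> x" for z
    using slope[of y z] that neq[of y z] neq[OF xy]
    by (simp add: transport_slope_def transport_arc_def insert_commute)
qed

context attached
begin

text \<open>Acyclicity supplies a potential on the tree, normalised to 0 at the root. Along the
  cycle the partial sums of \<open>del\<close> start at 0 there and return to 0 because the total
  vanishes, so the two pieces fit together.\<close>

lemma exists_transport_potential:
  assumes acyclic: "\<not> has_cycle E" and pos: "\<And>d. d \<in> GE \<Longrightarrow> 0 < w d"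
    and zero: "(\<Sum>i<g. del i) = 0" and le: "\<And>i. i < g \<Longrightarrow> \<bar>del i\<bar> \<le> w (ce i)"
    and slope: "\<And>i. i < g \<Longrightarrow> ce i \<inter> {x, y} \<noteq> {} \<Longrightarrow>
      del i = transport_slope w x y (vx i) (vx (i + 1))"
  shows "\<exists>f. transport_potential GE w x y f"
proof -
  have "\<exists>h. \<forall>a b. {a, b} \<in> E \<longrightarrow> h b - h a = transport_slope w x y (Inl a) (Inl b)"
    by (rule acyclic_potential[OF simple_graphD(2)[OF G] acyclic simple_graphD(6)[OF G]])
      (assumption | rule transport_slope_anti)+
  then obtain h where h: "\<And>a b. {a, b} \<in> E \<Longrightarrow> h b - h a = transport_slope w x y (Inl a) (Inl b)"
    by blast
  define f where "f v = (case v of Inl a \<Rightarrow> h a - h r | Inr i \<Rightarrow> \<Sum>k<i. del k)" for v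
  have f_vx: "f (vx i) = (\<Sum>k<i. del k)" if i: "i \<le> g" for i
  proof -
    consider "i = 0" | "i = g" | "0 < i" "i < g" using i by linarith
    then show ?thesis using zero by cases (simp_all add: vx_simps f_def)
  qed
  have f_del: "f (vx (i + 1)) - f (vx i) = del i" if "i < g" for i
    using f_vx[of i] f_vx[of "i + 1"] that by simp
  have "transport_potential GE w x y f"
    unfolding transport_potential_def
  proof (intro allI impI)
    fix u v assume uv: "{u, v} \<in> GE"
    show "\<bar>f v - f u\<bar> \<le> w {u, v} \<and>
      ({u, v} \<inter> {x, y} \<noteq> {} \<longrightarrow> f v - f u = transport_slope w x y u v)"
      using uv
    proof (cases rule: GE_cases)
      case (1 e)
      then obtain a b where e: "e = {a, b}" using simple_graphD(6)[OF G] by blast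
      then have "{u, v} = {Inl a, Inl b}" using 1(2) by simp
      then have "(u = Inl a \<and> v = Inl b) \<or> (u = Inl b \<and> v = Inl a)" unfolding doubleton_eq_iff .
      moreover have "{a, b} \<in> E" "{b, a} \<in> E" using 1(1) unfolding e insert_commute[of b a] by auto
      ultimately obtain a b where ab: "u = Inl a" "v = Inl b" "{a, b} \<in> E" by blast
      then have "f v - f u = transport_slope w x y u v" using h[OF ab(3)] by (simp add: f_def)
      then show ?thesis using transport_slope_le[of w u v x y] pos[OF uv] by simp
    next
      case (2 i)
      have "(u = vx i \<and> v = vx (i + 1)) \<or> (u = vx (i + 1) \<and> v = vx i)"
        using 2(2) unfolding cycle_edge_def doubleton_eq_iff by blast
      then show ?thesis
        unfolding 2(2)
      proof (elim disjE conjE)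
        assume uv: "u = vx i" "v = vx (i + 1)"
        show "\<bar>f v - f u\<bar> \<le> w (ce i) \<and>
            (ce i \<inter> {x, y} \<noteq> {} \<longrightarrow> f v - f u = transport_slope w x y u v)"
          unfolding uv f_del[OF 2(1)] using le[OF 2(1)] slope[OF 2(1)] by blast
      next
        assume uv: "u = vx (i + 1)" "v = vx i"
        have "f v - f u = - del i" using f_del[OF 2(1)] uv by simp
        then show "\<bar>f v - f u\<bar> \<le> w (ce i) \<and>
            (ce i \<inter> {x, y} \<noteq> {} \<longrightarrow> f v - f u = transport_slope w x y u v)"
          using le[OF 2(1)] slope[OF 2(1)] transport_slope_anti[of w x y v u] uv by simp
      qed
    qed
  qed
  then show ?thesis by blast
qed

text \<open>Of the cycle edges only the two at the root can carry a slope. Traversing the cycle, one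
  is left outwards and the other entered inwards; as their weights agree, the increments
  cancel.\<close>

lemma tree_edge_potential:
  assumes acyclic: "\<not> has_cycle E" and w: "perron_eigenvector GE w"
  shows "\<exists>f. transport_potential GE w (Inl a) (Inl b) f"
proof -
  have pos: "\<And>d. d \<in> GE \<Longrightarrow> 0 < w d" using w by (simp add: perron_eigenvector_def)
  define del where "del i = transport_slope w (Inl a) (Inl b) (vx i) (vx (i + 1))" for i
  have gS: "Suc (g - 1) = g" using g3 by simp
  have mid: "del i = 0" if "0 < i" "i < g - 1" for i
    unfolding del_def by (rule transport_slope_0) (use that in \<open>simp add: vx_simps\<close>)
  have "del 0 = transport_slope w (Inl a) (Inl b) (Inl r) (Inr 1)"
    using g3 by (simp add: del_def vx_simps)
  moreover have "w {Inl r, Inr 1} = w (ce 0)" using g3 by (simp add: ce_eq)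
  moreover have "del (g - 1) = transport_slope w (Inl a) (Inl b) (Inr (g - 1)) (Inl r)"
    using g3 by (simp add: del_def vx_simps)
  moreover have "w {Inr (g - 1), Inl r} = w (ce 0)"
    using g3 perron_cycle_order(1)[OF w] by (simp add: ce_eq)
  ultimately have ends: "del 0 + del (g - 1) = 0"
    by (simp add: transport_slope_def transport_arc_def)
  have "(\<Sum>i<g. del i) = del 0 + (\<Sum>i\<in>{0<..<g - 1}. del i) + del (g - 1)"
    using sum_lessThan_ends[of "g - 1" del] g3 unfolding gS by simp
  also have "\<dots> = 0" using ends mid by simp
  finally have zero: "(\<Sum>i<g. del i) = 0" .
  show ?thesis
  proof (rule exists_transport_potential[OF acyclic pos zero])
    show "\<bar>del i\<bar> \<le> w (ce i)" for i
      using pos[OF ce_in_GE[of i]] unfolding del_def cycle_edge_def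
      by (intro transport_slope_le less_imp_le)
    show "del i = transport_slope w (Inl a) (Inl b) (vx i) (vx (i + 1))" for i
      by (rule del_def)
  qed
qed

text \<open>Around a cycle edge the potential climbs along three consecutive edges; it can descend along
  the remaining ones because these are at least as long.\<close>

lemma cycle_edge_potential:
  assumes acyclic: "\<not> has_cycle E" and w: "perron_eigenvector GE w" and j: "j \<in> {1..g}"
    and short: "triple_weight r g w j \<le> cycle_length r g w / 2"
  shows "\<exists>f. transport_potential GE w (vx j) (vx (j + 1)) f"
proof -
  have pos: "\<And>d. d \<in> GE \<Longrightarrow> 0 < w d" using w by (simp add: perron_eigenvector_def)
  have cpos: "0 < w (ce i)" for i by (rule pos[OF ce_in_GE])
  \<comment> \<open>Writing \<open>j\<close> as a successor removes the truncated subtraction from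
    \<open>triple_weight\<close>.\<close>
  obtain k where k: "j = Suc k" "k < g" using j by (cases j) auto
  define L T where "L = cycle_length r g w" and "T = triple_weight r g w j"
  have T: "T = w (ce k) + w (ce (Suc k)) + w (ce (Suc (Suc k)))"
    by (simp add: T_def triple_weight_def k)
  have TL: "0 < T" "T \<le> L - T"
    using cpos[of k] cpos[of "Suc k"] cpos[of "Suc (Suc k)"] T short
    by (auto simp: L_def T_def)
  \<comment> \<open>The climb T is spread over the remaining length L - T, and \<open>t\<close> is
    the resulting rate of descent; t \<le> 1 is the hypothesis \<open>short\<close>.\<close>
  define t where "t = T / (L - T)"
  have t: "0 \<le> t" "t \<le> 1" "t * (L - T) = T" using TL by (auto simp: t_def)
  have vx_iff: "vx a = vx b \<longleftrightarrow> a mod g = b mod g" for a b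
    using vx_eq_iff[of "a mod g" "b mod g"] g3 by (simp add: vx_mod)
  have near: "a mod g \<noteq> b mod g" "b mod g \<noteq> a mod g" if "a < b" "b < a + 3" for a b
    using mod_neq_of_close[of a b g] that g3 by auto
  define K where "K = {k mod g, Suc k mod g, Suc (Suc k) mod g}"
  define del where "del i = (if i \<in> K then w (ce i) else - t * w (ce i))" for i
  have Kg: "K \<subseteq> {..<g}" using g3 by (auto simp: K_def)
  have sumK: "(\<Sum>i\<in>K. w (ce i)) = T"
    using near[of k "Suc k"] near[of k "Suc (Suc k)"] near[of "Suc k" "Suc (Suc k)"]
    by (simp add: K_def T ce_mod)
  have "(\<Sum>i<g. del i) = (\<Sum>i\<in>K. del i) + (\<Sum>i\<in>{..<g} - K. del i)"
    using Kg by (simp add: sum.subset_diff[of K "{..<g}"])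
  also have "\<dots> = T - t * (\<Sum>i\<in>{..<g} - K. w (ce i))"
    by (simp add: del_def sumK sum_negf flip: sum_distrib_left)
  also have "(\<Sum>i\<in>{..<g} - K. w (ce i)) = L - T"
    using Kg sumK by (simp add: sum_diff L_def cycle_length_eq)
  finally have zero: "(\<Sum>i<g. del i) = 0" using t(3) by simp
  have slope_K: "transport_slope w (vx j) (vx (j + 1)) (vx m) (vx (m + 1)) = w (ce m)"
    if "m = k \<or> m = Suc k \<or> m = Suc (Suc k)" for m
    using that near[of k "Suc k"] near[of k "Suc (Suc k)"] near[of "Suc k" "Suc (Suc k)"]
      near[of "Suc k" "Suc (Suc (Suc k))"] near[of "Suc (Suc k)" "Suc (Suc (Suc k))"]
    by (elim disjE) (simp_all add: transport_slope_def transport_arc_def vx_iff k cycle_edge_def)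
  show ?thesis
  proof (rule exists_transport_potential[OF acyclic pos zero])
    show "\<bar>del i\<bar> \<le> w (ce i)" for i
      using cpos[of i] t mult_left_le_one_le[of "w (ce i)" t] by (simp add: del_def abs_mult)
    show "del i = transport_slope w (vx j) (vx (j + 1)) (vx i) (vx (i + 1))"
      if i: "i < g" and touch: "ce i \<inter> {vx j, vx (j + 1)} \<noteq> {}" for i
    proof -
      have "i mod g = k mod g \<or> i mod g = Suc k mod g \<or> i mod g = Suc (Suc k) mod g"
        using touch by (auto simp: cycle_edge_def vx_iff k Suc_mod_cancel)
      then obtain m where m: "m = k \<or> m = Suc k \<or> m = Suc (Suc k)" "i mod g = m mod g" by blast
      then have "i \<in> K" using i by (auto simp: K_def)
      moreover have "vx i = vx m" "vx (i + 1) = vx (m + 1)"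
        using m(2) by (simp_all add: vx_iff Suc_mod_cancel)
      moreover have "ce i = ce m" using m(2) by (metis ce_mod)
      ultimately show ?thesis using slope_K[OF m(1)] by (simp add: del_def)
    qed
  qed
qed

lemma einstein:
  assumes acyclic: "\<not> has_cycle E" and w: "perron_eigenvector GE w"
    and short: "\<And>j. j \<in> {1..g} \<Longrightarrow> triple_weight r g w j \<le> cycle_length r g w / 2"
  shows "discrete_einstein_metric GV GE w (- lambda_max GE)"
  unfolding discrete_einstein_metric_def
proof (intro conjI allI impI)
  have pos: "\<And>d. d \<in> GE \<Longrightarrow> 0 < w d"
    and ev: "eigenvector_on GE (ricci_matrix GE) w (lambda_max GE)"
    using w by (auto simp: perron_eigenvector_def)
  show "\<forall>d\<in>GE. 0 < w d" using pos by blast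
  fix x y assume xy: "{x, y} \<in> GE"
  have "{x, y} \<in> (\<lambda>e. Inl ` e) ` E \<union> ce ` {1..g}" using xy unfolding attached_edges_def .
  then have "\<exists>f. transport_potential GE w x y f"
  proof
    assume "{x, y} \<in> (\<lambda>e. Inl ` e) ` E"
    then obtain e where e: "{x, y} = Inl ` e" by blast
    have "x \<in> Inl ` e" "y \<in> Inl ` e" using e by blast+
    then obtain a b where "x = Inl a" "y = Inl b" by blast
    then show ?thesis using tree_edge_potential[OF acyclic w] by simp
  next
    assume "{x, y} \<in> ce ` {1..g}"
    then obtain j where j: "j \<in> {1..g}" "{x, y} = {vx j, vx (j + 1)}"
      unfolding cycle_edge_def by blast
    obtain f where f: "transport_potential GE w (vx j) (vx (j + 1)) f"
      using cycle_edge_potential[OF acyclic w j(1) short[OF j(1)]] by blast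
    from j(2) have "(x = vx j \<and> y = vx (j + 1)) \<or> (x = vx (j + 1) \<and> y = vx j)"
      unfolding doubleton_eq_iff .
    then show ?thesis using f transport_potential_flip[OF f] by blast
  qed
  then obtain f where f: "transport_potential GE w x y f" by blast
  from has_lly_curvature_transport[OF simple connected xy pos f]
  show "has_lly_curvature GV GE w x y (- lambda_max GE)"
    using eigen_app[OF ev xy] pos[OF xy] by simp
qed

end

section \<open>The limit\<close>

lemma plus_inverse_strict_mono:
  fixes x y :: real
  assumes "1 < x" "x < y"
  shows "x + 1 / x < y + 1 / y"
proof -
  have xy: "1 < x * y" using mult_strict_mono[of 1 x 1 y] assms by simp
  have "0 < (y - x) * (x * y - 1)" using assms xy by simp
  then have "0 < (y - x) * (x * y - 1) / (x * y)" using xy by simp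
  also have "\<dots> = (y + 1 / y) - (x + 1 / x)" using assms by (simp add: field_simps)
  finally show ?thesis by simp
qed

text \<open>In t = 1 / m this is 1 - t / 2 - t^2 / 2, which exhibits the monotonicity and is the
  form in which the limit of \<open>end_ratio\<close> appears.\<close>

lemma g_star_eq: "m \<noteq> 0 \<Longrightarrow> g_star m = (2 + 1 / m) * (1 - 1 / m) / 2"
  by (simp add: g_star_def power2_eq_square field_simps)

lemma g_star_strict_mono: "strict_mono_on {1<..} g_star"
proof (rule strict_mono_onI)
  fix x y :: real assume "x \<in> {1<..}" "y \<in> {1<..}" "x < y"
  then have xy: "0 < x" "0 < y" "1 / y < 1 / x" by (auto simp: field_simps)
  then have "1 / y * (1 / y) < 1 / x * (1 / x)" by (intro mult_strict_mono) auto
  then show "g_star x < g_star y" using xy g_star_eq[of x] g_star_eq[of y] by (simp add: algebra_simps)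
qed

lemma golden_ratio: "1 < golden_ratio" "golden_ratio\<^sup>2 = golden_ratio + 1"
  "golden_ratio - 3 / 2 = (sqrt 5 - 2) / 2"
proof -
  have "1 < sqrt 5" by simp
  then show "1 < golden_ratio" by (simp add: golden_ratio_def)
  show "golden_ratio\<^sup>2 = golden_ratio + 1"
    by (simp add: golden_ratio_def power_divide power2_sum field_simps)
  show "golden_ratio - 3 / 2 = (sqrt 5 - 2) / 2" by (simp add: golden_ratio_def field_simps)
qed

lemma golden_root_iff: "1 < m \<Longrightarrow> m\<^sup>2 - m - 1 = 0 \<longleftrightarrow> m = golden_ratio"
proof -
  assume m: "1 < m"
  have "m\<^sup>2 - m - 1 = (m - golden_ratio) * (m + golden_ratio - 1)"
    using golden_ratio(2) by (simp add: power2_eq_square algebra_simps)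
  moreover have "m + golden_ratio - 1 \<noteq> 0" using m golden_ratio(1) by simp
  ultimately show ?thesis by simp
qed

lemma g_star_half_iff: "1 < m \<Longrightarrow> g_star m = 1 / 2 \<longleftrightarrow> m\<^sup>2 - m - 1 = 0"
proof -
  assume m: "1 < m"
  have "g_star m - 1 / 2 = (m\<^sup>2 - m - 1) / (2 * m\<^sup>2)"
    using m by (simp add: g_star_def power2_eq_square diff_frac_eq) (simp add: field_simps)
  moreover have "g_star m = 1 / 2 \<longleftrightarrow> g_star m - 1 / 2 = 0" by simp
  ultimately show ?thesis using m by simp
qed

lemma power_null_of_tendsto:
  fixes q :: "nat \<Rightarrow> real"
  assumes q: "q \<longlonglongrightarrow> l" and l: "l < 1" and nn: "\<forall>\<^sub>F n in sequentially. 0 \<le> q n"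
  shows "(\<lambda>n. q n ^ (n - k)) \<longlonglongrightarrow> 0"
proof -
  \<comment> \<open>The base varies with \<open>n\<close>, so a fixed bound strictly between its
    limit and 1 is needed; the maximum with 0 keeps that bound nonnegative.\<close>
  define c where "c = (max l 0 + 1) / 2"
  have c: "0 \<le> c" "c < 1" "l < c" using l by (auto simp: c_def)
  have "(\<lambda>n. c ^ (n - k)) \<longlonglongrightarrow> 0"
    by (rule filterlim_compose[OF LIMSEQ_power_zero filterlim_minus_const_nat_at_top]) (use c in simp)
  moreover have "\<forall>\<^sub>F n in sequentially. norm (q n ^ (n - k)) \<le> c ^ (n - k)"
    using order_tendstoD(2)[OF q c(3)] nn by eventually_elim (auto intro!: power_mono)
  ultimately show ?thesis by (rule Lim_null_comparison[rotated])
qed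

lemma end_ratio_tendsto:
  fixes q :: "nat \<Rightarrow> real"
  assumes q: "q \<longlonglongrightarrow> l" and l: "l < 1" and nn: "\<forall>\<^sub>F n in sequentially. 0 \<le> q n"
  shows "(\<lambda>g. end_ratio g (q g)) \<longlonglongrightarrow> (2 + l) * (1 - l) / 2"
proof -
  note p = power_null_of_tendsto[OF q l nn]
  have p0: "(\<lambda>g. q g ^ g) \<longlonglongrightarrow> 0" using p[of 0] by simp
  have "(\<lambda>g. end_ratio g (q g)) \<longlonglongrightarrow> (2 * (1 + 0) + (l + 0)) * (1 - l) / (2 * (1 - 0))"
    unfolding end_ratio_def by (intro tendsto_intros q p p0) simp
  then show ?thesis by simp
qed

theorem proposition5p8:
  fixes V :: "'a set" and E :: "'a set set" and r :: 'a
  assumes "rooted_tree V E r" and "E \<noteq> {}"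
  shows "\<exists>lam mu :: real.
      (\<lambda>g. lambda_max (attached_edges E r g)) \<longlonglongrightarrow> lam \<and> 0 < lam \<and>
      1 < mu \<and> mu + 1 / mu = 2 * (1 + lam) \<and>
      (\<forall>m. m \<noteq> 0 \<and> m + 1 / m = 2 * (1 + lam) \<longrightarrow> m \<le> mu) \<and>
      lam = (mu - 1)\<^sup>2 / (2 * mu) \<and>
      (\<forall>g\<ge>3. \<exists>w. perron_eigenvector (attached_edges E r g) w) \<and>
      (\<forall>w. (\<forall>g\<ge>3. perron_eigenvector (attached_edges E r g) (w g)) \<longrightarrow>
        (\<exists>r_inf. (\<lambda>g. max_triple_ratio r g (w g)) \<longlonglongrightarrow> r_inf \<and>
           r_inf = g_star mu \<and>
           (r_inf < 1 / 2 \<longleftrightarrow> lam < golden_ratio - 3 / 2) \<and>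
           (r_inf > 1 / 2 \<longleftrightarrow> lam > golden_ratio - 3 / 2))) \<and>
      strict_mono_on {1<..} g_star \<and>
      (\<forall>m>1. (g_star m = 1 / 2 \<longleftrightarrow> m\<^sup>2 - m - 1 = 0) \<and>
              (m\<^sup>2 - m - 1 = 0 \<longleftrightarrow> m = golden_ratio)) \<and>
      golden_ratio - 3 / 2 = (sqrt 5 - 2) / 2 \<and>
      (lam < golden_ratio - 3 / 2 \<longrightarrow>
        (\<forall>\<^sub>F g in sequentially. \<forall>w. perron_eigenvector (attached_edges E r g) w \<longrightarrow>
           (\<forall>j\<in>{1..g}. triple_weight r g w j \<le> cycle_length r g w / 2) \<and>
           discrete_einstein_metric (attached_verts V g) (attached_edges E r g) w
             (- lambda_max (attached_edges E r g))))"
proof -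
  have G: "simple_graph V E" and conn: "connected_graph V E" and acyclic: "\<not> has_cycle E" and rV: "r \<in> V"
    using assms(1) by (auto simp: rooted_tree_def)
  have att: "attached V E r g" if "3 \<le> g" for g
    by unfold_locales (use G conn rV assms(2) that in auto)
  define ev where "ev g = lambda_max (attached_edges E r g)" for g
  define c :: real where "c = 8 / 15 / (card E + 40)"
  have c: "0 < c" by (simp add: c_def add_nonneg_pos)
  have ev_ge: "c \<le> ev g" if "3 \<le> g" for g
    using attached.lambda_max_lower[OF att[OF that]] by (simp add: c_def ev_def)
  have ev_pos: "0 < ev g" if "3 \<le> g" for g using ev_ge[OF that] c by simp
  \<comment> \<open>The shift restricts the sequence to genuine cycles, g \<ge> 3, where the bounds
    hold.\<close>
  have "decseq (\<lambda>n. ev (n + 3))"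
  proof (rule decseq_SucI)
    fix n
    show "ev (Suc n + 3) \<le> ev (n + 3)"
      using attached.top_eigenvalue_Suc_le[OF att[of "n + 3"]] ev_pos[of "n + 3"] by (simp add: ev_def)
  qed
  then obtain lam where lim: "(\<lambda>n. ev (n + 3)) \<longlonglongrightarrow> lam"
    by (rule decseq_convergent[of _ c]) (auto intro: ev_ge)
  have ev_lim: "ev \<longlonglongrightarrow> lam" by (rule LIMSEQ_offset[OF lim])
  have "c \<le> lam" by (rule LIMSEQ_le_const[OF lim], intro exI allI impI, rule ev_ge) simp
  then have lam: "0 < lam" using c by simp
  define mu where "mu = char_root lam"
  have mu: "1 < mu" "mu + 1 / mu = 2 * (1 + lam)" using char_root[OF lam] by (auto simp: mu_def)
  have mu_max: "m \<le> mu" if "m \<noteq> 0" "m + 1 / m = 2 * (1 + lam)" for m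
    using plus_inverse_strict_mono[OF mu(1), of m] mu(2) that by fastforce
  have lam_eq: "lam = (mu - 1)\<^sup>2 / (2 * mu)"
  proof -
    have "2 * ((mu - 1)\<^sup>2 / (2 * mu)) = mu + 1 / mu - 2"
      using mu(1) by (simp add: power2_eq_square field_simps)
    moreover have "lam = x" if "2 * x = mu + 1 / mu - 2" for x using that mu(2) by simp
    ultimately show ?thesis by blast
  qed
  \<comment> \<open>mu = phi corresponds to lam = phi - 3/2, so strict growth of x + 1 / x turns
    comparisons of \<open>lam\<close> with the threshold into comparisons of \<open>mu\<close> with
    the golden ratio.\<close>
  have phi_eq: "golden_ratio + 1 / golden_ratio = 2 * (1 + (golden_ratio - 3 / 2))"
    using golden_ratio(1,2) by (simp add: power2_eq_square field_simps)
  have phi_half: "g_star golden_ratio = 1 / 2"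
    using g_star_half_iff golden_root_iff golden_ratio(1) by blast
  have less_phi: "lam < golden_ratio - 3 / 2 \<longleftrightarrow> mu < golden_ratio"
    and greater_phi: "lam > golden_ratio - 3 / 2 \<longleftrightarrow> mu > golden_ratio"
    using plus_inverse_strict_mono[OF mu(1), of golden_ratio]
      plus_inverse_strict_mono[OF golden_ratio(1), of mu] mu(2) phi_eq
    by (cases mu golden_ratio rule: linorder_cases; force)+
  have less_half: "g_star mu < 1 / 2 \<longleftrightarrow> mu < golden_ratio"
    and greater_half: "g_star mu > 1 / 2 \<longleftrightarrow> mu > golden_ratio"
    using strict_mono_onD[OF g_star_strict_mono, of mu golden_ratio]
      strict_mono_onD[OF g_star_strict_mono, of golden_ratio mu] mu(1) golden_ratio(1) phi_half
    by (cases mu golden_ratio rule: linorder_cases; force)+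
  define q where "q g = 1 / char_root (ev g)" for g
  have "(\<lambda>g. char_root (ev g)) \<longlonglongrightarrow> char_root lam"
    unfolding char_root_def by (intro tendsto_intros ev_lim)
  then have q_lim: "q \<longlonglongrightarrow> 1 / mu"
    unfolding q_def mu_def[symmetric] using mu(1) by (intro tendsto_intros) auto
  have ge3: "\<forall>\<^sub>F g in sequentially. (3::nat) \<le> g" by (rule eventually_ge_at_top)
  then have q_nn: "\<forall>\<^sub>F g in sequentially. 0 \<le> q g"
  proof eventually_elim
    case (elim g)
    then show ?case using char_root(1)[OF ev_pos[OF elim]] by (simp add: q_def)
  qed
  have ratio_lim: "(\<lambda>g. end_ratio g (q g)) \<longlonglongrightarrow> g_star mu"
  proof -
    have "g_star mu = (2 + 1 / mu) * (1 - 1 / mu) / 2" by (rule g_star_eq) (use mu(1) in simp)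
    moreover have "1 / mu < 1" using mu(1) by simp
    ultimately show ?thesis by (simp only: end_ratio_tendsto[OF q_lim _ q_nn])
  qed
  have ratio: "max_triple_ratio r g w = end_ratio g (q g)"
    if "3 \<le> g" "perron_eigenvector (attached_edges E r g) w" for g w
    using attached.max_triple_ratio_eq[OF att[OF that(1)] that(2)] by (simp add: q_def ev_def)
  have perron_ex: "\<exists>w. perron_eigenvector (attached_edges E r g) w" if "3 \<le> g" for g
  proof -
    interpret attached V E r g by (rule att[OF that])
    show ?thesis using top_exists by (simp add: perron_eigenvector_def lambda_max_GE)
  qed
  have limit: "\<exists>r_inf. (\<lambda>g. max_triple_ratio r g (w g)) \<longlonglongrightarrow> r_inf \<and> r_inf = g_star mu \<and>
      (r_inf < 1 / 2 \<longleftrightarrow> lam < golden_ratio - 3 / 2) \<and>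
      (r_inf > 1 / 2 \<longleftrightarrow> lam > golden_ratio - 3 / 2)"
    if w: "\<forall>g\<ge>3. perron_eigenvector (attached_edges E r g) (w g)" for w
  proof -
    have "\<forall>\<^sub>F g in sequentially. end_ratio g (q g) = max_triple_ratio r g (w g)"
      using ge3 by eventually_elim (use ratio w in simp)
    then have "(\<lambda>g. max_triple_ratio r g (w g)) \<longlonglongrightarrow> g_star mu"
      by (rule Lim_transform_eventually[OF ratio_lim])
    then show ?thesis using less_phi greater_phi less_half greater_half by blast
  qed
  have einstein: "\<forall>\<^sub>F g in sequentially. \<forall>w. perron_eigenvector (attached_edges E r g) w \<longrightarrow>
      (\<forall>j\<in>{1..g}. triple_weight r g w j \<le> cycle_length r g w / 2) \<and>
      discrete_einstein_metric (attached_verts V g) (attached_edges E r g) w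
        (- lambda_max (attached_edges E r g))"
    if "lam < golden_ratio - 3 / 2"
  proof -
    have "g_star mu < 1 / 2" using that less_phi less_half by blast
    from order_tendstoD(2)[OF ratio_lim this]
    have "\<forall>\<^sub>F g in sequentially. end_ratio g (q g) < 1 / 2" .
    then show ?thesis using ge3
    proof eventually_elim
      case (elim g)
      show ?case
      proof (intro allI impI)
        fix w assume w: "perron_eigenvector (attached_edges E r g) w"
        interpret attached V E r g by (rule att[OF elim(2)])
        have short: "triple_weight r g w j \<le> cycle_length r g w / 2" if "j \<in> {1..g}" for j
        proof -
          have "triple_weight r g w j / cycle_length r g w \<le> max_triple_ratio r g w"
            unfolding max_triple_ratio_def using that by (intro Max_ge) auto
          also have "\<dots> < 1 / 2" using ratio[OF elim(2) w] elim(1) by simp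
          finally show ?thesis using cycle_length_pos[OF w] by (simp add: field_simps)
        qed
        then show "(\<forall>j\<in>{1..g}. triple_weight r g w j \<le> cycle_length r g w / 2) \<and>
            discrete_einstein_metric (attached_verts V g) (attached_edges E r g) w
              (- lambda_max (attached_edges E r g))"
          using einstein[OF acyclic w short] by blast
      qed
    qed
  qed
  show ?thesis
  proof (rule exI[of _ lam], rule exI[of _ mu], intro conjI)
    show "(\<lambda>g. lambda_max (attached_edges E r g)) \<longlonglongrightarrow> lam" using ev_lim unfolding ev_def .
    show "\<forall>m. m \<noteq> 0 \<and> m + 1 / m = 2 * (1 + lam) \<longrightarrow> m \<le> mu" using mu_max by blast
    show "\<forall>g\<ge>3. \<exists>w. perron_eigenvector (attached_edges E r g) w" using perron_ex by blast
    show "\<forall>m>1. (g_star m = 1 / 2 \<longleftrightarrow> m\<^sup>2 - m - 1 = 0) \<and> (m\<^sup>2 - m - 1 = 0 \<longleftrightarrow> m = golden_ratio)"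
      using g_star_half_iff golden_root_iff by blast
    show "\<forall>w. (\<forall>g\<ge>3. perron_eigenvector (attached_edges E r g) (w g)) \<longrightarrow>
        (\<exists>r_inf. (\<lambda>g. max_triple_ratio r g (w g)) \<longlonglongrightarrow> r_inf \<and> r_inf = g_star mu \<and>
           (r_inf < 1 / 2 \<longleftrightarrow> lam < golden_ratio - 3 / 2) \<and>
           (r_inf > 1 / 2 \<longleftrightarrow> lam > golden_ratio - 3 / 2))"
      by (intro allI impI) (rule limit)
    show "lam < golden_ratio - 3 / 2 \<longrightarrow>
        (\<forall>\<^sub>F g in sequentially. \<forall>w. perron_eigenvector (attached_edges E r g) w \<longrightarrow>
           (\<forall>j\<in>{1..g}. triple_weight r g w j \<le> cycle_length r g w / 2) \<and>
           discrete_einstein_metric (attached_verts V g) (attached_edges E r g) w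
             (- lambda_max (attached_edges E r g)))"
      by (intro impI) (rule einstein)
  qed (fact lam mu lam_eq g_star_strict_mono golden_ratio(3))+
qed

end
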